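(* For any lower semicomputable prior $w$ and any $\varepsilon>0$, there is an $\varepsilon$-optimal (deterministic) policy for AIXI that is $\Delta^0_2$; that is, with $\xi$ the Bayesian mixture over all lower semicomputable chronological contextual semimeasures with prior $w$, there is a deterministic policy $\pi$ with $V^*_\xi(\ae_{<t})-V^\pi_\xi(\ae_{<t})<\varepsilon$ for all histories $\ae_{<t}$ such that the set $\{(h,a):\pi(h)=a\}$ is $\Delta^0_2$ (limit computable).
   Context: The action set $\mathcal{A}$ and percept set $\mathcal{E}$ are finite; a percept is $e=(o,r)$ with reward $r\in[0,1]$. A history is $\ae_{<t}=a_1e_1\ldots a_{t-1}e_{t-1}\in(\mathcal{A}\times\mathcal{E})^*$. Policies are deterministic maps from histories to actions, identified with their graphs, encoded computably as sets of natural numbers; $\Delta^0_2$ refers to the arithmetical hierarchy. A chronological contextual semimeasure $\nu$ assigns to all equal-length $e_{1:t}\in\mathcal{E}^t$, $a_{1:t}\in\mathcal{A}^t$ a number $\nu(e_{1:t}\,\|\,a_{1:t})\in[0,1]$ with $\nu(\epsilon\,\|\,\epsilon)\le1$ and $\sum_{e_t\in\mathcal{E}}\nu(e_{1:t}\,\|\,a_{1:t})\le\nu(e_{<t}\,\|\,a_{<t})$; it is lower semicomputable if $\{(e_{1:t},a_{1:t},q):q\in\mathbb{Q},\ \nu(e_{1:t}\,\|\,a_{1:t})>q\}$ is recursively enumerable. Let $\nu_1,\nu_2,\ldots$ be a computable enumeration (uniformly lower semicomputable) of all lower semicomputable chronological contextual semimeasures. A lower semicomputable prior is a map $i\mapsto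 w(\nu_i)>0$ with $\sum_iw(\nu_i)\le1$ that is lower semicomputable; the Bayesian mixture is $\xi:=\sum_iw(\nu_i)\nu_i$. AIXI is the $\xi$-optimal policy. The discount function $\gamma:\mathbb{N}\to\mathbb{R}_{\ge0}$ is computable and summable, $\Gamma_t:=\sum_{k\ge t}\gamma_k$. The value of $\pi$ in $\nu$ after a history with $\nu(e_{<t}\,\|\,a_{<t})>0$ is $$V^\pi_\nu(\ae_{<t})=\frac1{\Gamma_t}\sum_{k=t}^\infty\gamma_k\sum_{e_{t:k}}r_k\,\frac{\nu(e_{1:k}\,\|\,a_{1:k})}{\nu(e_{<t}\,\|\,a_{<t})},\qquad a_i:=\pi(\ae_{<i})\text{ for }i\ge t,$$ if $\Gamma_t>0$, and $0$ if $\Gamma_t=0$; $V^*_\nu:=\sup_\pi V^\pi_\nu$. *)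

theory Defs
  imports "HOL-Analysis.Analysis" "HOL-Library.Nat_Bijection"
begin

text \<open>
  Total recursive functions in the sense of Goedel and Kleene: minimisation is applied to
  regular functions only. An \<open>n\<close>-ary function takes its arguments as a list of length \<open>n\<close>;
  its values on lists of other lengths carry no meaning.
\<close>

inductive recursive_fun :: "nat \<Rightarrow> (nat list \<Rightarrow> nat) \<Rightarrow> bool" where
  zero: "recursive_fun 0 (\<lambda>xs. 0)"
| succ: "recursive_fun 1 (\<lambda>xs. Suc (hd xs))"
| proj: "i < n \<Longrightarrow> recursive_fun n (\<lambda>xs. xs ! i)"
| comp: "recursive_fun (length gs) f \<Longrightarrow> (\<forall>g\<in>set gs. recursive_fun n g) \<Longrightarrow>
    recursive_fun n (\<lambda>xs. f (map (\<lambda>g. g xs) gs))"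
| prim_rec: "recursive_fun n f \<Longrightarrow> recursive_fun (Suc (Suc n)) g \<Longrightarrow>
    recursive_fun (Suc n) (\<lambda>xs. rec_nat (f (tl xs)) (\<lambda>k v. g (k # v # tl xs)) (hd xs))"
| minim: "recursive_fun (Suc n) f \<Longrightarrow> (\<forall>xs. length xs = n \<longrightarrow> (\<exists>y. f (y # xs) = 0)) \<Longrightarrow>
    recursive_fun n (\<lambda>xs. LEAST y. f (y # xs) = 0)"

definition decidable_rel :: "nat \<Rightarrow> (nat list \<Rightarrow> bool) \<Rightarrow> bool" where
  "decidable_rel n R \<longleftrightarrow>
    (\<exists>f. recursive_fun n f \<and> (\<forall>xs. length xs = n \<longrightarrow> f xs = (if R xs then 1 else 0)))"

definition recursively_enumerable :: "nat set \<Rightarrow> bool" where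
  "recursively_enumerable A \<longleftrightarrow> (\<exists>R. decidable_rel 2 R \<and> A = {x. \<exists>k. R [x, k]})"

definition Sigma02 :: "nat set \<Rightarrow> bool" where
  "Sigma02 A \<longleftrightarrow> (\<exists>R. decidable_rel 3 R \<and> A = {x. \<exists>k. \<forall>l. R [x, k, l]})"

definition Pi02 :: "nat set \<Rightarrow> bool" where
  "Pi02 A \<longleftrightarrow> (\<exists>R. decidable_rel 3 R \<and> A = {x. \<forall>k. \<exists>l. R [x, k, l]})"

definition Delta02 :: "nat set \<Rightarrow> bool" where
  "Delta02 A \<longleftrightarrow> Sigma02 A \<and> Pi02 A"

text \<open>
  A surjective numbering of the rationals. Every code of a rational is used below, so no
  canonical representation is needed.
\<close>

definition rat_of_code :: "nat \<Rightarrow> rat" where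
  "rat_of_code n =
    (case prod_decode n of (a, b) \<Rightarrow> of_int (int_decode a) / of_nat (Suc b))"

text \<open>The argument \<open>c\<close> encodes the domain of \<open>f\<close> as natural numbers.\<close>

definition lower_semicomputable :: "('x \<Rightarrow> nat) \<Rightarrow> ('x \<Rightarrow> real) \<Rightarrow> bool" where
  "lower_semicomputable c f \<longleftrightarrow>
    recursively_enumerable {prod_encode (c x, n) | x n. f x > of_rat (rat_of_code n)}"

text \<open>
  A real-valued function is computable if it can be approximated to any given precision,
  uniformly in the argument, that is, if it is semicomputable from below and from above.
\<close>

definition computable_real_fun :: "('x \<Rightarrow> nat) \<Rightarrow> ('x \<Rightarrow> real) \<Rightarrow> bool" where
  "computable_real_fun c f \<longleftrightarrow>
    lower_semicomputable c f \<and> lower_semicomputable c (\<lambda>x. - f x)"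

text \<open>
  A numbering of a finite type. The choice is immaterial, as any two numberings of a finite
  set are computably interchangeable.
\<close>

definition finite_code :: "'x::finite \<Rightarrow> nat" where
  "finite_code = (SOME f. bij_betw f UNIV {..<CARD('x)})"

text \<open>
  A history lists the action-percept pairs in chronological order. Two sequences
  \<open>e\<^sub>1 \<dots> e\<^sub>t\<close> and \<open>a\<^sub>1 \<dots> a\<^sub>t\<close> of equal length are the same thing as a history of
  length \<open>t\<close>, and \<open>\<nu>(e\<^sub>1 \<dots> e\<^sub>t || a\<^sub>1 \<dots> a\<^sub>t)\<close> is written as \<open>\<nu>\<close> applied to that history.
\<close>

type_synonym ('a, 'e) history = "('a \<times> 'e) list"
type_synonym ('a, 'e) policy = "('a, 'e) history \<Rightarrow> 'a"
type_synonym ('a, 'e) environment = "('a, 'e) history \<Rightarrow> real"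

definition history_code :: "('a::finite, 'e::finite) history \<Rightarrow> nat" where
  "history_code h = list_encode (map (\<lambda>(a, e). prod_encode (finite_code a, finite_code e)) h)"

definition policy_graph_code :: "('a::finite, 'e::finite) policy \<Rightarrow> nat set" where
  "policy_graph_code \<pi> = {prod_encode (history_code h, finite_code a) | h a. \<pi> h = a}"

definition chronological_semimeasure :: "('a::finite, 'e::finite) environment \<Rightarrow> bool" where
  "chronological_semimeasure \<nu> \<longleftrightarrow>
    (\<forall>h. 0 \<le> \<nu> h \<and> \<nu> h \<le> 1) \<and>
    (\<forall>h a. (\<Sum>e\<in>UNIV. \<nu> (h @ [(a, e)])) \<le> \<nu> h)"

text \<open>
  A sequence, possibly with repetitions, of exactly the lower semicomputable chronological
  contextual semimeasures that is lower semicomputable uniformly in the index.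
\<close>

definition computable_enumeration :: "(nat \<Rightarrow> ('a::finite, 'e::finite) environment) \<Rightarrow> bool" where
  "computable_enumeration \<nu> \<longleftrightarrow>
    range \<nu> = {\<mu>. chronological_semimeasure \<mu> \<and> lower_semicomputable history_code \<mu>} \<and>
    lower_semicomputable (\<lambda>(i, h). prod_encode (i, history_code h)) (\<lambda>(i, h). \<nu> i h)"

definition lower_semicomputable_prior :: "(nat \<Rightarrow> real) \<Rightarrow> bool" where
  "lower_semicomputable_prior w \<longleftrightarrow>
    (\<forall>i. w i > 0) \<and> summable w \<and> (\<Sum>i. w i) \<le> 1 \<and> lower_semicomputable id w"

definition bayes_mixture ::
  "(nat \<Rightarrow> real) \<Rightarrow> (nat \<Rightarrow> ('a, 'e) environment) \<Rightarrow> ('a, 'e) environment" where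
  "bayes_mixture w \<nu> h = (\<Sum>i. w i * \<nu> i h)"

definition discount_function :: "(nat \<Rightarrow> real) \<Rightarrow> bool" where
  "discount_function \<gamma> \<longleftrightarrow> (\<forall>k. \<gamma> k \<ge> 0) \<and> summable \<gamma> \<and> computable_real_fun id \<gamma>"

definition discount_tail :: "(nat \<Rightarrow> real) \<Rightarrow> nat \<Rightarrow> real" where
  "discount_tail \<gamma> t = (\<Sum>j. \<gamma> (t + j))"

text \<open>
  \<open>extend \<pi> h es\<close> continues \<open>h\<close> with the percepts \<open>es\<close> and the actions that \<open>\<pi>\<close> takes in between.
\<close>

fun extend :: "('a, 'e) policy \<Rightarrow> ('a, 'e) history \<Rightarrow> 'e list \<Rightarrow> ('a, 'e) history" where
  "extend \<pi> h [] = h"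
| "extend \<pi> h (e # es) = extend \<pi> (h @ [(\<pi> h, e)]) es"

text \<open>
  For a percept \<open>e = (o, r)\<close>, \<open>reward e\<close> is the component \<open>r\<close>; the observation plays no
  further role. Time starts at 1, so the first percept after \<open>h\<close> arrives at time \<open>t = length h + 1\<close>. The
  summation index \<open>j\<close> stands for \<open>k = t + j\<close>, and \<open>es\<close> for the \<open>j + 1\<close> percepts at times
  \<open>t, \<dots>, k\<close>. If \<open>\<nu> h = 0\<close>, division by zero makes the value 0.
\<close>

definition policy_value ::
  "(nat \<Rightarrow> real) \<Rightarrow> ('e::finite \<Rightarrow> real) \<Rightarrow> ('a::finite, 'e) environment \<Rightarrow> ('a, 'e) policy
    \<Rightarrow> ('a, 'e) history \<Rightarrow> real" where
  "policy_value \<gamma> reward \<nu> \<pi> h =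
    (let t = length h + 1 in
     if discount_tail \<gamma> t > 0 then
       1 / discount_tail \<gamma> t *
       (\<Sum>j. \<gamma> (t + j) *
         (\<Sum>es\<in>{es. length es = j + 1}. reward (last es) * (\<nu> (extend \<pi> h es) / \<nu> h)))
     else 0)"

definition optimal_value ::
  "(nat \<Rightarrow> real) \<Rightarrow> ('e::finite \<Rightarrow> real) \<Rightarrow> ('a::finite, 'e) environment \<Rightarrow> ('a, 'e) history
    \<Rightarrow> real" where
  "optimal_value \<gamma> reward \<nu> h = (SUP \<pi>. policy_value \<gamma> reward \<nu> \<pi> h)"

end

theory Submission
  imports Defs
begin

text \<open>
  Every quantity that enters the optimal value of the mixture is nonnegative and lower
  semicomputable, and the (unnormalised) optimal value is monotone in these quantities. Replacing
  them by their lower approximations at stage \<open>s\<close>, and cutting off the backward induction at the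
  histories with code at least \<open>s\<close>, gives recursive approximations that increase to a solution
  \<open>V\<close> of the Bellman equation. The policy keeps its action from one stage to the next as long as
  it loses at most a small fraction of the approximate value, and otherwise switches to a currently
  best action. By monotonicity the action eventually stabilises, so that the policy is limit
  computable. As the loss at time \<open>t\<close> is a fraction of order \<open>2 ^ - t\<close> of the value, no division by
  the mixture or by the discount tail is needed. The rewards need not be computable, but they can
  be rounded to multiples of \<open>2 ^ - m\<close>.
\<close>

section \<open>Recursive functions\<close>

text \<open>Limit computability of the values alone would not give a limit computable policy:
  between two actions of equal value the currently best one can alternate forever, and equality of
  the limits cannot be detected at any stage. This forces some tolerance. An absolute tolerance
  would have to be measured in units of \<open>discount_tail\<close> times \<open>\<xi> h\<close>,
  the denominator of the value, which can be arbitrarily small. A tolerance relative to the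
  approximate value only compares two increasing sequences at one stage, and since the value is at
  most that denominator, it becomes an absolute error after normalisation. All stages compute with
  natural numbers. An approximation is a numerator over a denominator that depends only on the
  stage, so growth reads \<open>c * F s \<le> F (Suc s)\<close>. Denominators multiply:
  \<open>2 ^ s\<close> for the discount and \<open>4 ^ s\<close> for the mixture (prior times
  environment), hence \<open>8 ^ s\<close>, times \<open>2 ^ m\<close> for the rewards. The final
  error is \<open>2 / 2 ^ m\<close>, one half from the tolerance and one half from the
  rounding.\<close>

definition recursive_on :: "nat \<Rightarrow> (nat list \<Rightarrow> nat) \<Rightarrow> bool" where
  "recursive_on n f \<longleftrightarrow> (\<exists>f'. recursive_fun n f' \<and> (\<forall>xs. length xs = n \<longrightarrow> f' xs = f xs))"

text \<open>Almost everything below is phrased with unary functions, several arguments being packed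
  by \<open>prod_encode\<close>. Recursiveness goals can then be decomposed by introduction rules
  without reference to argument lists.\<close>

definition recursive :: "(nat \<Rightarrow> nat) \<Rightarrow> bool" where
  "recursive f \<longleftrightarrow> recursive_on 1 (\<lambda>xs. f (xs ! 0))"

text \<open>This is what \<open>recursive_on\<close> offers over \<open>recursive_fun\<close>: the
  schemes produce particular functions on all lists, and their values on lists of the wrong length
  would otherwise obstruct every rewriting.\<close>

lemma recursive_on_cong:
  "recursive_on n f \<Longrightarrow> (\<And>xs. length xs = n \<Longrightarrow> f xs = g xs) \<Longrightarrow> recursive_on n g"
  unfolding recursive_on_def by metis

lemma recursive_on_nth: "i < n \<Longrightarrow> recursive_on n (\<lambda>xs. xs ! i)"
  unfolding recursive_on_def using recursive_fun.proj by blast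

lemma recursive_on_comp:
  assumes "recursive_on (length gs) f" "\<forall>g\<in>set gs. recursive_on n g"
  shows "recursive_on n (\<lambda>xs. f (map (\<lambda>g. g xs) gs))"
proof -
  obtain f' where f': "recursive_fun (length gs) f'" "\<And>xs. length xs = length gs \<Longrightarrow> f' xs = f xs"
    using assms(1) unfolding recursive_on_def by blast
  obtain r where r: "\<And>g. g \<in> set gs \<Longrightarrow> recursive_fun n (r g)"
    "\<And>g xs. g \<in> set gs \<Longrightarrow> length xs = n \<Longrightarrow> r g xs = g xs"
    using assms(2) unfolding recursive_on_def by metis
  have "recursive_fun n (\<lambda>xs. f' (map (\<lambda>g. g xs) (map r gs)))"
    using f'(1) r(1) by (intro recursive_fun.comp) auto
  moreover have "f' (map (\<lambda>g. g xs) (map r gs)) = f (map (\<lambda>g. g xs) gs)" if "length xs = n" for xs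
  proof -
    have "map (\<lambda>g. g xs) (map r gs) = map (\<lambda>g. g xs) gs"
      using r(2) that by simp
    then show ?thesis
      by (simp only: f'(2) length_map)
  qed
  ultimately show ?thesis
    unfolding recursive_on_def by blast
qed

lemma recursive_on_comp1:
  assumes "recursive_on 1 f" "recursive_on n g"
  shows "recursive_on n (\<lambda>xs. f [g xs])"
  using recursive_on_comp[of "[g]" f n] assms by simp

lemma recursive_on_comp2:
  assumes "recursive_on 2 f" "recursive_on n g" "recursive_on n h"
  shows "recursive_on n (\<lambda>xs. f [g xs, h xs])"
  using recursive_on_comp[of "[g, h]" f n] assms by (simp add: numeral_2_eq_2)

lemma recursive_on_Suc: "recursive_on n f \<Longrightarrow> recursive_on n (\<lambda>xs. Suc (f xs))"
  using recursive_on_comp1[of "\<lambda>xs. Suc (hd xs)" n f] recursive_fun.succ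
  unfolding recursive_on_def[of 1] by auto

lemma recursive_on_const: "recursive_on n (\<lambda>xs. c)"
proof (induction c)
  case 0
  have "recursive_on 0 (\<lambda>xs. 0)"
    unfolding recursive_on_def using recursive_fun.zero by blast
  then show ?case
    using recursive_on_comp[of "[]" "\<lambda>xs. 0" n] by simp
qed (rule recursive_on_Suc)

text \<open>The basic scheme recurses on the first argument. Composing it with \<open>b\<close> and
  the \<open>n\<close> projections allows a computed bound while all arguments stay available as
  parameters.\<close>

lemma recursive_on_rec_nat:
  assumes "recursive_on n f" "recursive_on (Suc (Suc n)) g" "recursive_on n b"
  shows "recursive_on n (\<lambda>xs. rec_nat (f xs) (\<lambda>k v. g (k # v # xs)) (b xs))"
proof -
  obtain f' where f': "recursive_fun n f'" "\<And>xs. length xs = n \<Longrightarrow> f' xs = f xs"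
    using assms(1) unfolding recursive_on_def by blast
  obtain g' where g': "recursive_fun (Suc (Suc n)) g'"
    "\<And>xs. length xs = Suc (Suc n) \<Longrightarrow> g' xs = g xs"
    using assms(2) unfolding recursive_on_def by blast
  have "recursive_on (Suc n) (\<lambda>xs. rec_nat (f' (tl xs)) (\<lambda>k v. g' (k # v # tl xs)) (hd xs))"
    unfolding recursive_on_def using recursive_fun.prim_rec[OF f'(1) g'(1)] by blast
  from this have "recursive_on (length (b # map (\<lambda>i xs. xs ! i) [0..<n]))
    (\<lambda>xs. rec_nat (f' (tl xs)) (\<lambda>k v. g' (k # v # tl xs)) (hd xs))" by simp
  then have "recursive_on n (\<lambda>xs. (\<lambda>xs. rec_nat (f' (tl xs)) (\<lambda>k v. g' (k # v # tl xs)) (hd xs))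
     (map (\<lambda>g. g xs) (b # map (\<lambda>i xs. xs ! i) [0..<n])))"
    by (rule recursive_on_comp) (use assms(3) recursive_on_nth in auto)
  then show ?thesis
  proof (rule recursive_on_cong, goal_cases)
    case (1 xs)
    then have "map (\<lambda>g. g xs) (map (\<lambda>i xs. xs ! i) [0..<n]) = xs"
      by (auto intro: nth_equalityI)
    with 1 show ?case
      by (simp add: f' g')
  qed
qed

lemma recursive_on_add:
  assumes "recursive_on n f" "recursive_on n g"
  shows "recursive_on n (\<lambda>xs. f xs + g xs)"
proof -
  have "recursive_on n (\<lambda>xs. rec_nat (f xs) (\<lambda>k v. (\<lambda>ys. Suc (ys ! 1)) (k # v # xs)) (g xs))"
    by (intro recursive_on_rec_nat assms recursive_on_Suc recursive_on_nth) simp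
  moreover have "rec_nat a (\<lambda>k v. Suc v) b = a + b" for a b :: nat
    by (induction b) auto
  ultimately show ?thesis by simp
qed

lemma recursive_on_diff:
  assumes "recursive_on n f" "recursive_on n g"
  shows "recursive_on n (\<lambda>xs. f xs - g xs)"
proof -
  \<comment> \<open>The predecessor, as a recursion whose step returns its counter. It is stated for
    \<open>n + 2\<close> arguments and index 1, since the outer recursion passes its accumulator
    there.\<close>
  have "recursive_on (Suc (Suc n))
      (\<lambda>xs. rec_nat 0 (\<lambda>k v. (\<lambda>ys. ys ! 0) (k # v # xs)) (xs ! 1))"
    by (intro recursive_on_rec_nat recursive_on_const recursive_on_nth) auto
  moreover have "rec_nat 0 (\<lambda>k v. k) b = b - 1" for b :: nat
    by (cases b) auto
  ultimately have "recursive_on (Suc (Suc n)) (\<lambda>xs. xs ! 1 - 1)"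
    by simp
  then have "recursive_on n
      (\<lambda>xs. rec_nat (f xs) (\<lambda>k v. (\<lambda>ys. ys ! 1 - 1) (k # v # xs)) (g xs))"
    by (intro recursive_on_rec_nat assms)
  moreover have "rec_nat a (\<lambda>k v. v - 1) b = a - b" for a b :: nat
    by (induction b) auto
  ultimately show ?thesis by simp
qed

lemma recursive_on_triangle:
  assumes "recursive_on n f"
  shows "recursive_on n (\<lambda>xs. triangle (f xs))"
proof -
  have "recursive_on n
      (\<lambda>xs. rec_nat 0 (\<lambda>k v. (\<lambda>ys. ys ! 1 + Suc (ys ! 0)) (k # v # xs)) (f xs))"
    by (intro recursive_on_rec_nat assms recursive_on_add recursive_on_Suc recursive_on_nth
        recursive_on_const) auto
  moreover have "rec_nat 0 (\<lambda>k v. v + Suc k) b = triangle b" for b :: nat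
    by (induction b) auto
  ultimately show ?thesis by simp
qed

lemma recursive_on_prod_encode:
  assumes "recursive_on n f" "recursive_on n g"
  shows "recursive_on n (\<lambda>xs. prod_encode (f xs, g xs))"
proof -
  have "recursive_on n (\<lambda>xs. triangle (f xs + g xs) + f xs)"
    by (intro recursive_on_add recursive_on_triangle assms)
  then show ?thesis
    by (simp add: prod_encode_def)
qed

lemma recursiveI: "recursive_on 1 (\<lambda>xs. f (xs ! 0)) \<Longrightarrow> recursive f"
  by (simp add: recursive_def)

lemma recursive_on_recursive:
  assumes "recursive f" "recursive_on n g"
  shows "recursive_on n (\<lambda>xs. f (g xs))"
  using recursive_on_comp1[of "\<lambda>xs. f (xs ! 0)" n g] assms by (simp add: recursive_def)

lemma recursive_comp: "recursive f \<Longrightarrow> recursive g \<Longrightarrow> recursive (\<lambda>x. f (g x))"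
  unfolding recursive_def[of g]
  by (rule recursiveI) (rule recursive_on_recursive)

text \<open>\<open>k\<close> is the diagonal of the Cantor pairing on which \<open>x\<close> lies,
  and \<open>x - triangle k\<close> is the position on it. Decoding thus becomes arithmetic plus one
  minimisation.\<close>

lemma triangle_bounds_prod_decode:
  fixes x :: nat
  defines "k \<equiv> LEAST k. x < triangle (Suc k)"
  shows "triangle k \<le> x" "x < triangle (Suc k)"
    "prod_decode x = (x - triangle k, k - (x - triangle k))"
proof -
  have "x < triangle (Suc x)"
    by (induction x) auto
  then show upper: "x < triangle (Suc k)"
    unfolding k_def by (rule LeastI[of "\<lambda>k. x < triangle (Suc k)"])
  show lower: "triangle k \<le> x"
  proof (cases k)
    case (Suc k')
    then have "k' < (LEAST k. x < triangle (Suc k))"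
      unfolding k_def[symmetric] by simp
    then have "\<not> x < triangle (Suc k')"
      by (rule not_less_Least)
    then show ?thesis
      using Suc by simp
  qed simp
  have "x - triangle k \<le> k"
    using upper by simp
  then have "prod_encode (x - triangle k, k - (x - triangle k)) = x"
    using lower by (simp add: prod_encode_def)
  then show "prod_decode x = (x - triangle k, k - (x - triangle k))"
    using prod_encode_inverse[of "(x - triangle k, k - (x - triangle k))"] by simp
qed

text \<open>The truncated difference \<open>Suc x - triangle (Suc k)\<close> vanishes exactly when
  \<open>x < triangle (Suc k)\<close>. Such a \<open>k\<close> always exists, so the minimisation is
  regular.\<close>

lemma recursive_triangle_root: "recursive (\<lambda>x. LEAST k. x < triangle (Suc k))"
proof -
  have "recursive_on 2 (\<lambda>xs. Suc (xs ! 1) - triangle (Suc (xs ! 0)))"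
    by (intro recursive_on_diff recursive_on_Suc recursive_on_triangle recursive_on_nth) auto
  then obtain f where "recursive_fun 2 f"
    and f2: "\<And>xs. length xs = 2 \<Longrightarrow> f xs = Suc (xs ! 1) - triangle (Suc (xs ! 0))"
    unfolding recursive_on_def by blast
  then have f1: "recursive_fun (Suc 1) f"
    by (simp only: numeral_2_eq_2 One_nat_def)
  have eq: "f (y # xs) = 0 \<longleftrightarrow> xs ! 0 < triangle (Suc y)" if "length xs = 1" for y xs
    using that f2[of "y # xs"] by (simp add: less_Suc_eq_le)
  have "\<exists>y. f (y # xs) = 0" if "length xs = 1" for xs
    unfolding eq[OF that] by (rule exI) (rule triangle_bounds_prod_decode(2))
  then have "recursive_fun 1 (\<lambda>xs. LEAST y. f (y # xs) = 0)" (is "recursive_fun 1 ?g")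
    by (intro recursive_fun.minim[OF f1]) simp
  moreover have "?g xs = (LEAST k. xs ! 0 < triangle (Suc k))" if "length xs = 1" for xs
    by (simp only: eq[OF that])
  ultimately have "recursive_fun 1 ?g \<and>
      (\<forall>xs. length xs = 1 \<longrightarrow> ?g xs = (LEAST k. xs ! 0 < triangle (Suc k)))"
    by blast
  then show ?thesis
    unfolding recursive_def recursive_on_def by (rule exI[of _ ?g])
qed

lemma recursive_prod_decode:
  "recursive (\<lambda>x. fst (prod_decode x))" "recursive (\<lambda>x. snd (prod_decode x))"
  unfolding triangle_bounds_prod_decode(3) fst_conv snd_conv
  by (rule recursiveI; intro recursive_on_diff recursive_on_triangle recursive_on_nth
      recursive_on_recursive[OF recursive_triangle_root]; simp)+

section \<open>Closure rules for unary recursive functions\<close>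

named_theorems recursive_intros

lemma recursive_id [recursive_intros]: "recursive (\<lambda>x. x)"
  by (intro recursiveI recursive_on_nth) simp

lemma recursive_const [recursive_intros]: "recursive (\<lambda>x. c)"
  by (intro recursiveI recursive_on_const)

lemma recursive_Suc [recursive_intros]: "recursive f \<Longrightarrow> recursive (\<lambda>x. Suc (f x))"
  by (intro recursiveI recursive_on_Suc) (simp add: recursive_def)

lemma recursive_add [recursive_intros]:
  "recursive f \<Longrightarrow> recursive g \<Longrightarrow> recursive (\<lambda>x. f x + g x)"
  by (intro recursiveI recursive_on_add) (simp_all add: recursive_def)

lemma recursive_diff [recursive_intros]:
  "recursive f \<Longrightarrow> recursive g \<Longrightarrow> recursive (\<lambda>x. f x - g x)"
  by (intro recursiveI recursive_on_diff) (simp_all add: recursive_def)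

lemma recursive_prod_encode [recursive_intros]:
  "recursive f \<Longrightarrow> recursive g \<Longrightarrow> recursive (\<lambda>x. prod_encode (f x, g x))"
  by (intro recursiveI recursive_on_prod_encode) (simp_all add: recursive_def)

lemmas [recursive_intros] = recursive_comp[OF recursive_prod_decode(1)]
  recursive_comp[OF recursive_prod_decode(2)]

text \<open>The step function receives parameter, counter and accumulator packed as
  \<open>prod_encode (x, prod_encode (k, v))\<close>, so its recursiveness is again a goal about a
  unary function.\<close>

lemma recursive_rec_nat [recursive_intros]:
  assumes "recursive f" "recursive b"
    and "recursive (\<lambda>y. g (fst (prod_decode y)) (fst (prod_decode (snd (prod_decode y))))
      (snd (prod_decode (snd (prod_decode y)))))" (is "recursive ?g")
  shows "recursive (\<lambda>x. rec_nat (f x) (\<lambda>k v. g x k v) (b x))"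
proof -
  have "recursive_on 3 (\<lambda>ys. ?g (prod_encode (ys ! 2, prod_encode (ys ! 0, ys ! 1))))"
    by (intro recursive_on_recursive[OF assms(3)] recursive_on_prod_encode recursive_on_nth) auto
  then have "recursive_on (Suc (Suc 1)) (\<lambda>ys. g (ys ! 2) (ys ! 0) (ys ! 1))"
    by (simp add: numeral_3_eq_3)
  then have "recursive_on 1 (\<lambda>xs. rec_nat (f (xs ! 0))
      (\<lambda>k v. (\<lambda>ys. g (ys ! 2) (ys ! 0) (ys ! 1)) (k # v # xs)) (b (xs ! 0)))"
    using assms(1,2) unfolding recursive_def by (intro recursive_on_rec_nat)
  then show ?thesis
    by (intro recursiveI) simp
qed

lemma recursive_if_le [recursive_intros]:
  assumes "recursive a" "recursive b" "recursive f" "recursive g"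
  shows "recursive (\<lambda>x. if a x \<le> b x then f x else g x)"
proof -
  \<comment> \<open>A recursion whose step ignores its accumulator is a case distinction on whether
    the truncated difference is zero.\<close>
  have "recursive (\<lambda>x. rec_nat (f x) (\<lambda>k v. g x) (a x - b x))"
    by (intro recursive_intros assms recursive_comp[OF assms(4)])
  moreover have "rec_nat (f x) (\<lambda>k v. g x) (a x - b x) = (if a x \<le> b x then f x else g x)" for x
    by (cases "a x - b x") auto
  ultimately show ?thesis by simp
qed

lemma recursive_if_eq [recursive_intros]:
  assumes "recursive a" "recursive b" "recursive f" "recursive g"
  shows "recursive (\<lambda>x. if a x = b x then f x else g x)"
proof -
  have "recursive (\<lambda>x. if (a x - b x) + (b x - a x) \<le> 0 then f x else g x)"
    by (intro recursive_intros assms)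
  moreover have "(a x - b x) + (b x - a x) \<le> 0 \<longleftrightarrow> a x = b x" for x
    by auto
  ultimately show ?thesis by simp
qed

lemma recursive_max [recursive_intros]:
  "recursive f \<Longrightarrow> recursive g \<Longrightarrow> recursive (\<lambda>x. max (f x) (g x))"
  unfolding max_def by (intro recursive_intros)

lemma recursive_mult [recursive_intros]:
  assumes "recursive f" "recursive g"
  shows "recursive (\<lambda>x. f x * g x)"
proof -
  have "recursive (\<lambda>x. rec_nat 0 (\<lambda>k v. v + f x) (g x))"
    by (intro recursive_intros assms recursive_comp[OF assms(1)])
  moreover have "rec_nat 0 (\<lambda>k v. v + a) b = a * b" for a b :: nat
    by (induction b) auto
  ultimately show ?thesis by simp
qed

lemma recursive_power [recursive_intros]:
  assumes "recursive f" "recursive g"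
  shows "recursive (\<lambda>x. f x ^ g x)"
proof -
  have "recursive (\<lambda>x. rec_nat 1 (\<lambda>k v. f x * v) (g x))"
    by (intro recursive_intros assms recursive_comp[OF assms(1)])
  moreover have "rec_nat 1 (\<lambda>k v. a * v) b = a ^ b" for a b :: nat
    by (induction b) auto
  ultimately show ?thesis by simp
qed

lemma recursive_sum [recursive_intros]:
  assumes "recursive n" "recursive (\<lambda>y. f (fst (prod_decode y)) (snd (prod_decode y)))"
  shows "recursive (\<lambda>x. \<Sum>k<n x. f x k)"
proof -
  have "recursive (\<lambda>y. f (fst (prod_decode y)) (fst (prod_decode (snd (prod_decode y)))))"
    using recursive_comp[OF assms(2), of "\<lambda>y. prod_encode (fst (prod_decode y),
      fst (prod_decode (snd (prod_decode y))))"]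
    by (simp add: recursive_intros)
  then have "recursive (\<lambda>x. rec_nat 0 (\<lambda>k v. v + f x k) (n x))"
    by (intro recursive_intros assms)
  moreover have "rec_nat 0 (\<lambda>k v. v + f x k) m = (\<Sum>k<m. f x k)" for x m
    by (induction m) auto
  ultimately show ?thesis by simp
qed

lemma recursive_comp2:
  assumes "recursive (\<lambda>y. f (fst (prod_decode y)) (snd (prod_decode y)))" "recursive a" "recursive b"
  shows "recursive (\<lambda>x. f (a x) (b x))"
  using recursive_comp[OF assms(1), of "\<lambda>x. prod_encode (a x, b x)"] assms(2,3)
  by (simp add: recursive_prod_encode)

text \<open>A finite table is a nest of case distinctions. The rounded rewards enter the computation
  in this way.\<close>

lemma recursive_finite_support: "(\<And>k. n \<le> k \<Longrightarrow> f k = 0) \<Longrightarrow> recursive f"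
proof (induction n arbitrary: f)
  case 0
  then have "f = (\<lambda>k. 0)" by auto
  then show ?case
    by (simp add: recursive_const)
next
  case (Suc n)
  have "recursive (f(n := 0))"
    by (rule Suc.IH) (use Suc.prems in \<open>auto simp: le_Suc_eq\<close>)
  then have "recursive (\<lambda>k. if k = n then f n else (f(n := 0)) k)"
    by (intro recursive_if_eq recursive_id recursive_const)
  also have "(\<lambda>k. if k = n then f n else (f(n := 0)) k) = f"
    by auto
  finally show ?case .
qed

lemma decidable_rel_3I:
  assumes "recursive f"
  shows "decidable_rel 3 (\<lambda>xs. f (prod_encode (xs ! 0, prod_encode (xs ! 1, xs ! 2))) = 1)"
proof -
  have "recursive (\<lambda>x. if f x = 1 then 1 else 0)"
    by (intro recursive_intros assms)
  then have "recursive_on 3 (\<lambda>xs. if f (prod_encode (xs ! 0, prod_encode (xs ! 1, xs ! 2))) = 1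
      then 1 else 0)"
    by (rule recursive_on_recursive) (intro recursive_on_prod_encode recursive_on_nth; simp)
  then show ?thesis
    unfolding decidable_rel_def recursive_on_def .
qed

lemma decidable_rel_2E:
  assumes "decidable_rel 2 R"
  obtains d where "recursive d" "\<And>x k. d (prod_encode (x, k)) = (if R [x, k] then 1 else 0)"
proof -
  obtain f where f: "recursive_fun 2 f" "\<And>xs. length xs = 2 \<Longrightarrow> f xs = (if R xs then 1 else 0)"
    using assms unfolding decidable_rel_def by blast
  have "recursive_on 2 f"
    using f(1) unfolding recursive_on_def by blast
  then have "recursive_on 1 (\<lambda>xs. f [fst (prod_decode (xs ! 0)), snd (prod_decode (xs ! 0))])"
    by (rule recursive_on_comp2) (intro recursive_prod_decode[unfolded recursive_def])+
  then have "recursive (\<lambda>y. f [fst (prod_decode y), snd (prod_decode y)])"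
    by (rule recursiveI)
  then show ?thesis
    by (rule that) (simp add: f(2))
qed

section \<open>Bounded maxima\<close>

primrec max_below :: "nat \<Rightarrow> (nat \<Rightarrow> nat) \<Rightarrow> nat" where
  "max_below 0 f = 0"
| "max_below (Suc n) f = max (max_below n f) (f n)"

primrec argmax_below :: "nat \<Rightarrow> (nat \<Rightarrow> nat) \<Rightarrow> nat" where
  "argmax_below 0 f = 0"
| "argmax_below (Suc n) f = (if f n \<le> f (argmax_below n f) then argmax_below n f else n)"

lemma max_below_ge: "k < n \<Longrightarrow> f k \<le> max_below n f"
  by (induction n) (auto simp: less_Suc_eq le_max_iff_disj)

lemma argmax_below:
  assumes "0 < n"
  shows "argmax_below n f < n" "f (argmax_below n f) = max_below n f"
proof -
  have "argmax_below n f < n \<and> f (argmax_below n f) = max_below n f"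
    using assms by (induction n) (auto simp: max_def less_Suc_eq)
  then show "argmax_below n f < n" "f (argmax_below n f) = max_below n f"
    by auto
qed

lemma recursive_max_below [recursive_intros]:
  assumes "recursive n" "recursive (\<lambda>y. f (fst (prod_decode y)) (snd (prod_decode y)))"
  shows "recursive (\<lambda>x. max_below (n x) (f x))"
proof -
  have "recursive (\<lambda>x. rec_nat 0 (\<lambda>k v. max v (f x k)) (n x))"
    by (intro recursive_intros assms recursive_comp2[OF assms(2)])
  moreover have "rec_nat 0 (\<lambda>k v. max v (f x k)) m = max_below m (f x)" for x m
    by (induction m) auto
  ultimately show ?thesis by simp
qed

lemma recursive_argmax_below [recursive_intros]:
  assumes "recursive n" "recursive (\<lambda>y. f (fst (prod_decode y)) (snd (prod_decode y)))"
  shows "recursive (\<lambda>x. argmax_below (n x) (f x))"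
proof -
  have "recursive (\<lambda>x. rec_nat 0 (\<lambda>k v. if f x k \<le> f x v then v else k) (n x))"
    by (intro recursive_intros assms recursive_comp2[OF assms(2)])
  moreover have "rec_nat 0 (\<lambda>k v. if f x k \<le> f x v then v else k) m = argmax_below m (f x)" for x m
    by (induction m) auto
  ultimately show ?thesis by simp
qed

text \<open>A left fold over a coded list by plain primitive recursion. The state pairs the code of
  the remaining list with the accumulator; each round pops one head, and a state with empty list
  (code 0) is left alone. The code \<open>c\<close> itself serves as the number of rounds, since it
  bounds the length of the list.\<close>

definition fold_code :: "(nat \<Rightarrow> nat \<Rightarrow> nat) \<Rightarrow> nat \<Rightarrow> nat \<Rightarrow> nat" where
  "fold_code g c z = snd (prod_decode (rec_nat (prod_encode (c, z))
    (\<lambda>k v. if fst (prod_decode v) = 0 then v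
      else prod_encode (snd (prod_decode (fst (prod_decode v) - 1)),
        g (fst (prod_decode (fst (prod_decode v) - 1))) (snd (prod_decode v)))) c))"

lemma length_le_list_encode: "length xs \<le> list_encode xs"
proof (induction xs)
  case (Cons x xs)
  then show ?case
    using le_prod_encode_2[of "list_encode xs" x] by simp
qed simp

lemma rec_nat_eq_funpow: "rec_nat a (\<lambda>k. f) n = (f ^^ n) a"
  by (induction n) auto

lemma fold_code_list_encode [simp]: "fold_code g (list_encode xs) z = fold g xs z"
proof -
  define f where "f v = (if fst (prod_decode v) = 0 then v
    else prod_encode (snd (prod_decode (fst (prod_decode v) - 1)),
        g (fst (prod_decode (fst (prod_decode v) - 1))) (snd (prod_decode v))))" for v
  have "(f ^^ n) (prod_encode (list_encode xs, z)) = prod_encode (0, fold g xs z)"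
    if "length xs \<le> n" for n
    using that
  proof (induction xs arbitrary: n z)
    case Nil
    have "f (prod_encode (0, z)) = prod_encode (0, z)"
      by (simp add: f_def)
    then have "(f ^^ n) (prod_encode (0, z)) = prod_encode (0, z)"
      by (induction n) auto
    then show ?case by simp
  next
    case (Cons x xs)
    then obtain n' where n': "n = Suc n'" "length xs \<le> n'"
      by (auto simp: Suc_le_eq intro: that[of "n - 1"])
    have "f (prod_encode (list_encode (x # xs), z)) = prod_encode (list_encode xs, g x z)"
      by (simp add: f_def)
    then show ?case
      using Cons.IH[OF n'(2)] by (simp add: n'(1) funpow_Suc_right del: funpow.simps list_encode.simps)
  qed
  from this[OF length_le_list_encode] show ?thesis
    unfolding fold_code_def f_def[symmetric] rec_nat_eq_funpow by simp
qed

lemma recursive_fold_code: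
  assumes "recursive (\<lambda>y. g (fst (prod_decode y)) (snd (prod_decode y)))" "recursive c" "recursive z"
  shows "recursive (\<lambda>x. fold_code g (c x) (z x))"
  unfolding fold_code_def by (intro recursive_intros assms(2,3) recursive_comp2[OF assms(1)])

definition rev_code :: "nat \<Rightarrow> nat" where
  "rev_code c = fold_code (\<lambda>a b. Suc (prod_encode (a, b))) c 0"

definition length_code :: "nat \<Rightarrow> nat" where
  "length_code c = fold_code (\<lambda>a b. Suc b) c 0"

definition nth_code :: "nat \<Rightarrow> nat \<Rightarrow> nat" where
  "nth_code c i = fst (prod_decode (rec_nat c (\<lambda>k v. snd (prod_decode (v - 1))) i - 1))"

lemma rev_code_list_encode [simp]: "rev_code (list_encode xs) = list_encode (rev xs)"
proof -
  have "fold (\<lambda>a b. Suc (prod_encode (a, b))) xs (list_encode ys) = list_encode (rev xs @ ys)" for ys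
    by (induction xs arbitrary: ys) (simp_all flip: list_encode.simps)
  from this[of "[]"] show ?thesis
    by (simp add: rev_code_def)
qed

lemma length_code_list_encode [simp]: "length_code (list_encode xs) = length xs"
proof -
  have "fold (\<lambda>a b. Suc b) xs m = length xs + m" for m
    by (induction xs arbitrary: m) simp_all
  then show ?thesis
    by (simp add: length_code_def)
qed

text \<open>Reading past the end of a coded list gives 0, because 0 codes the empty list and both
  \<open>0 - 1\<close> and the components of \<open>prod_decode 0\<close> are 0. Later this supplies
  the value 0 beyond the cut-off.\<close>

lemma nth_code_0 [simp]: "nth_code 0 i = 0"
proof -
  have [simp]: "prod_decode 0 = (0, 0)"
    by (simp add: prod_decode_def prod_decode_aux.simps)
  have "rec_nat 0 (\<lambda>k v. snd (prod_decode (v - 1))) i = 0"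
    by (induction i) auto
  then show ?thesis
    by (simp add: nth_code_def)
qed

lemma nth_code_Suc [simp]:
  "nth_code (Suc (prod_encode (a, c))) 0 = a"
  "nth_code (Suc (prod_encode (a, c))) (Suc i) = nth_code c i"
  by (simp_all add: nth_code_def rec_nat_eq_funpow funpow_Suc_right del: funpow.simps(2))

lemma recursive_rev_code [recursive_intros]: "recursive f \<Longrightarrow> recursive (\<lambda>x. rev_code (f x))"
  unfolding rev_code_def by (intro recursive_fold_code recursive_intros)

lemma recursive_length_code [recursive_intros]:
  "recursive f \<Longrightarrow> recursive (\<lambda>x. length_code (f x))"
  unfolding length_code_def by (intro recursive_fold_code recursive_intros)

lemma recursive_nth_code [recursive_intros]:
  "recursive f \<Longrightarrow> recursive g \<Longrightarrow> recursive (\<lambda>x. nth_code (f x) (g x))"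
  unfolding nth_code_def by (intro recursive_intros)

text \<open>The easy direction of Shoenfield's limit lemma.\<close>

lemma Delta02_limitI:
  assumes f: "recursive (\<lambda>y. f (fst (prod_decode y)) (snd (prod_decode y)))"
    and lim: "\<And>x. \<exists>S. \<forall>s\<ge>S. f s x = 1 \<longleftrightarrow> x \<in> A"
  shows "Delta02 A"
proof -
  have "recursive (\<lambda>y. f (fst (prod_decode (snd (prod_decode y))) + snd (prod_decode (snd (prod_decode y))))
      (fst (prod_decode y)))"
    by (intro recursive_comp2[OF f] recursive_intros)
  from decidable_rel_3I[OF this] have dec: "decidable_rel 3 (\<lambda>xs. f (xs ! 1 + xs ! 2) (xs ! 0) = 1)"
    by simp
  have "x \<in> A \<longleftrightarrow> (\<exists>k. \<forall>l. f (k + l) x = 1)" "x \<in> A \<longleftrightarrow> (\<forall>k. \<exists>l. f (k + l) x = 1)" for x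
  proof -
    obtain S where S: "\<And>s. S \<le> s \<Longrightarrow> f s x = 1 \<longleftrightarrow> x \<in> A"
      using lim by blast
    have *: "f (k + S) x = 1 \<longleftrightarrow> x \<in> A" "f (S + k) x = 1 \<longleftrightarrow> x \<in> A" for k
      by (rule S, simp)+
    show "x \<in> A \<longleftrightarrow> (\<exists>k. \<forall>l. f (k + l) x = 1)" "x \<in> A \<longleftrightarrow> (\<forall>k. \<exists>l. f (k + l) x = 1)"
      using * by blast+
  qed
  then have "A = {x. \<exists>k. \<forall>l. f (k + l) x = 1}" "A = {x. \<forall>k. \<exists>l. f (k + l) x = 1}"
    by blast+
  then show ?thesis
    unfolding Delta02_def Sigma02_def Pi02_def
    by (intro conjI exI[of _ "\<lambda>xs. f (xs ! 1 + xs ! 2) (xs ! 0) = 1"] dec) simp_all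
qed

section \<open>Lower semicomputable functions\<close>

text \<open>Even numbers code the nonnegative integers and the denominator is stored minus one,
  whence \<open>2 * j\<close> and \<open>2 ^ i - 1\<close>.\<close>

lemma rat_of_code_dyadic:
  "of_rat (rat_of_code (prod_encode (2 * j, 2 ^ i - 1))) = (real j / 2 ^ i :: real)"
proof -
  have "int_decode (2 * j) = int j"
    using int_encode_inverse[of "int j"] by (simp add: int_encode_def sum_encode_def)
  then show ?thesis
    by (simp add: rat_of_code_def of_rat_divide of_rat_power)
qed

text \<open>A number \<open>z\<close> coding \<open>(i, (j, k))\<close> is a certificate if
  \<open>k\<close> witnesses the enumeration of \<open>j / 2 ^ i < f x\<close>. Stage
  \<open>s\<close> takes the largest certified fraction among all \<open>z < s\<close>, written over
  the denominator \<open>2 ^ s\<close>; as \<open>i \<le> z\<close>, the rescaled numerator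
  \<open>j * 2 ^ (s - i)\<close> is exact. The doubling inequality says that the quotients increase,
  and it holds also at numbers \<open>y\<close> that code nothing.\<close>

lemma lower_semicomputable_approx:
  assumes "lower_semicomputable c f" "inj c" "\<And>x. 0 \<le> f x"
  obtains F :: "nat \<Rightarrow> nat \<Rightarrow> nat"
  where "recursive (\<lambda>y. F (fst (prod_decode y)) (snd (prod_decode y)))"
    and "\<And>s y. 2 * F s y \<le> F (Suc s) y"
    and "\<And>s x. F s (c x) / 2 ^ s \<le> f x"
    and "\<And>x. (\<lambda>s. F s (c x) / 2 ^ s) \<longlonglongrightarrow> f x"
proof -
  obtain R where R: "decidable_rel 2 R"
    "{prod_encode (c x, n) | x n. f x > of_rat (rat_of_code n)} = {x. \<exists>k. R [x, k]}"
    using assms(1) unfolding lower_semicomputable_def recursively_enumerable_def by blast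
  obtain d where d: "recursive d" "\<And>x k. d (prod_encode (x, k)) = (if R [x, k] then 1 else 0)"
    using decidable_rel_2E[OF R(1)] by blast
  have R_iff: "(\<exists>k. R [prod_encode (c x, n), k]) \<longleftrightarrow> of_rat (rat_of_code n) < f x" for x n
  proof -
    have "(\<exists>k. R [prod_encode (c x, n), k]) \<longleftrightarrow>
        prod_encode (c x, n) \<in> {prod_encode (c x, n) | x n. f x > of_rat (rat_of_code n)}"
      unfolding R(2) by simp
    also have "\<dots> \<longleftrightarrow> of_rat (rat_of_code n) < f x"
      using assms(2) by (auto dest: injD)
    finally show ?thesis .
  qed
  define t where "t s y z =
    d (prod_encode (prod_encode (y, prod_encode (2 * fst (prod_decode (snd (prod_decode z))),
        2 ^ fst (prod_decode z) - 1)), snd (prod_decode (snd (prod_decode z)))))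
    * (fst (prod_decode (snd (prod_decode z))) * 2 ^ (s - fst (prod_decode z)))" for s y z
  define F where "F s y = max_below s (t s y)" for s y
  have t: "t s y (prod_encode (i, prod_encode (j, k))) =
      (if R [prod_encode (y, prod_encode (2 * j, 2 ^ i - 1)), k] then j * 2 ^ (s - i) else 0)"
    for s y i j k
    by (simp add: t_def d(2))
  have rec: "recursive (\<lambda>y. F (fst (prod_decode y)) (snd (prod_decode y)))"
    unfolding F_def t_def by (intro recursive_intros recursive_comp[OF d(1)])
  have rescale: "real (j * 2 ^ (s - i)) / 2 ^ s = real j / 2 ^ i" if "i \<le> s" for i j s
    using that by (auto simp: le_iff_add power_add)
  have mono: "2 * F s y \<le> F (Suc s) y" for s y
  proof (cases "s = 0")
    case False
    define z where "z = argmax_below s (t s y)"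
    have z: "z < s" "F s y = t s y z"
      using argmax_below[of s "t s y"] False by (auto simp: z_def F_def)
    obtain i j k where ijk: "z = prod_encode (i, prod_encode (j, k))"
      by (metis prod_decode_inverse surj_pair)
    have "i \<le> s"
      using z(1) le_prod_encode_1[of i "prod_encode (j, k)"] by (simp add: ijk)
    then have "2 * t s y z = t (Suc s) y z"
      by (simp add: ijk t Suc_diff_le)
    also have "\<dots> \<le> F (Suc s) y"
      unfolding F_def using z(1) by (intro max_below_ge) simp
    finally show ?thesis
      by (simp add: z(2))
  qed (simp add: F_def)
  have le: "F s (c x) / 2 ^ s \<le> f x" for s x
  proof (cases "s = 0")
    case False
    define z where "z = argmax_below s (t s (c x))"
    have z: "z < s" "F s (c x) = t s (c x) z"
      using argmax_below[of s "t s (c x)"] False by (auto simp: z_def F_def)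
    obtain i j k where ijk: "z = prod_encode (i, prod_encode (j, k))"
      by (metis prod_decode_inverse surj_pair)
    have "i \<le> s"
      using z(1) le_prod_encode_1[of i "prod_encode (j, k)"] by (simp add: ijk)
    show ?thesis
    proof (cases "R [prod_encode (c x, prod_encode (2 * j, 2 ^ i - 1)), k]")
      case True
      then have "real j / 2 ^ i < f x"
        using R_iff[of x "prod_encode (2 * j, 2 ^ i - 1)"] rat_of_code_dyadic[of j i] by auto
      moreover have "F s (c x) = j * 2 ^ (s - i)"
        by (simp only: z(2) ijk t True if_True)
      ultimately show ?thesis
        using rescale[OF \<open>i \<le> s\<close>, of j] by simp
    qed (simp add: z(2) ijk t assms(3))
  qed (simp add: F_def assms(3))
  have lim: "(\<lambda>s. F s (c x) / 2 ^ s) \<longlonglongrightarrow> f x" for x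
  proof (rule increasing_LIMSEQ)
    show "F s (c x) / 2 ^ s \<le> F (Suc s) (c x) / 2 ^ Suc s" for s
    proof -
      have "real (2 * F s (c x)) \<le> real (F (Suc s) (c x))"
        using mono by (simp only: of_nat_le_iff)
      then show ?thesis
        by (simp add: field_simps)
    qed
    show "F s (c x) / 2 ^ s \<le> f x" for s
      by (rule le)
    fix e :: real
    assume "0 < e"
    show "\<exists>s. f x \<le> F s (c x) / 2 ^ s + e"
    proof (cases "f x = 0")
      case False
      then have pos: "0 < f x"
        using assms(3)[of x] by simp
      obtain i where "(1 / 2 :: real) ^ i < e"
        using real_arch_pow_inv[OF \<open>0 < e\<close>, of "1 / 2"] by auto
      then have i: "1 / 2 ^ i < e"
        by (simp add: power_divide)
      \<comment> \<open>The ceiling minus one keeps \<open>j / 2 ^ i\<close> strictly below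
        \<open>f x\<close>, as a certificate demands, and within \<open>1 / 2 ^ i\<close> of it. If
        \<open>f x = 0\<close> there are no certificates, and the default value 0 is exact.\<close>
      define j where "j = nat (\<lceil>f x * 2 ^ i\<rceil> - 1)"
      have "0 < f x * 2 ^ i"
        using pos by simp
      then have "\<lceil>f x * 2 ^ i\<rceil> \<ge> 1"
        by linarith
      then have "real j = \<lceil>f x * 2 ^ i\<rceil> - 1"
        by (simp add: j_def)
      then have j: "real j < f x * 2 ^ i" "f x * 2 ^ i \<le> real j + 1"
        by linarith+
      from j(1) have "real j / 2 ^ i < f x"
        by (simp add: field_simps)
      then obtain k where k: "R [prod_encode (c x, prod_encode (2 * j, 2 ^ i - 1)), k]"
        using R_iff[of x "prod_encode (2 * j, 2 ^ i - 1)"] rat_of_code_dyadic[of j i] by auto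
      \<comment> \<open>The certificate is examined from stage \<open>Suc z\<close> on.\<close>
      define z where "z = prod_encode (i, prod_encode (j, k))"
      have "i \<le> z"
        by (simp add: z_def le_prod_encode_1)
      have "j * 2 ^ (Suc z - i) = t (Suc z) (c x) z"
        by (simp only: z_def t k if_True)
      also have "\<dots> \<le> F (Suc z) (c x)"
        unfolding F_def by (intro max_below_ge) simp
      finally have "real (j * 2 ^ (Suc z - i)) \<le> real (F (Suc z) (c x))"
        by (simp only: of_nat_le_iff)
      then have "real (j * 2 ^ (Suc z - i)) / 2 ^ Suc z \<le> F (Suc z) (c x) / 2 ^ Suc z"
        by (rule divide_right_mono) simp
      moreover have "real (j * 2 ^ (Suc z - i)) / 2 ^ Suc z = real j / 2 ^ i"
        using \<open>i \<le> z\<close> by (intro rescale) simp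
      moreover have "f x \<le> real j / 2 ^ i + 1 / 2 ^ i"
        using j(2) by (simp add: field_simps)
      ultimately show ?thesis
        using i by (intro exI[of _ "Suc z"]) linarith
    qed (use \<open>0 < e\<close> in \<open>auto intro!: exI[of _ 0]\<close>)
  qed
  show ?thesis
    using that[OF rec mono le lim] .
qed

section \<open>Values of policies\<close>

lemma length_extend [simp]: "length (extend \<pi> h es) = length h + length es"
  by (induction es arbitrary: h) auto

lemma extend_snoc [simp]:
  "extend \<pi> h (es @ [e]) = extend \<pi> h es @ [(\<pi> (extend \<pi> h es), e)]"
  by (induction es arbitrary: h) auto

text \<open>If \<open>\<phi>\<close> carries the weight of the environment, this is the unnormalised
  expectation of a quantity \<open>n\<close> steps ahead.\<close>

definition path_sum ::
  "(('a, 'e::finite) history \<Rightarrow> real) \<Rightarrow> ('a, 'e) policy \<Rightarrow> ('a, 'e) history \<Rightarrow> nat \<Rightarrow> real" where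
  "path_sum \<phi> \<pi> h n = (\<Sum>es\<in>{es. length es = n}. \<phi> (extend \<pi> h es))"

lemma sum_lists_length_Suc:
  fixes f :: "'e::finite list \<Rightarrow> real"
  shows "(\<Sum>es\<in>{es. length es = Suc n}. f es) = (\<Sum>es\<in>{es. length es = n}. \<Sum>e\<in>UNIV. f (es @ [e]))"
proof -
  have "{es :: 'e list. length es = Suc n} = (\<lambda>(es, e). es @ [e]) ` ({es. length es = n} \<times> UNIV)"
    by (auto simp: image_iff length_Suc_conv_rev)
  moreover have "inj_on (\<lambda>(es, e). es @ [e]) ({es :: 'e list. length es = n} \<times> UNIV)"
    by (auto intro: inj_onI)
  ultimately show ?thesis
    by (simp add: sum.reindex sum.cartesian_product split_def)
qed

lemma path_sum_0 [simp]: "path_sum \<phi> \<pi> h 0 = \<phi> h"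
  by (simp add: path_sum_def)

text \<open>The last percept is split off, rather than the first, so that an inequality between a
  history and its children can be applied under the sum by \<open>path_sum_mono\<close>.\<close>

lemma path_sum_Suc:
  "path_sum \<phi> \<pi> h (Suc n) = path_sum (\<lambda>h. \<Sum>e\<in>UNIV. \<phi> (h @ [(\<pi> h, e)])) \<pi> h n"
  by (simp add: path_sum_def sum_lists_length_Suc)

lemma path_sum_add: "path_sum (\<lambda>h. \<phi> h + \<psi> h) \<pi> h n = path_sum \<phi> \<pi> h n + path_sum \<psi> \<pi> h n"
  by (simp add: path_sum_def sum.distrib)

lemma path_sum_mono:
  "(\<And>h'. length h' = length h + n \<Longrightarrow> \<phi> h' \<le> \<psi> h') \<Longrightarrow> path_sum \<phi> \<pi> h n \<le> path_sum \<psi> \<pi> h n"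
  unfolding path_sum_def by (intro sum_mono) simp

lemma path_sum_cmult: "path_sum (\<lambda>h. c * \<phi> h) \<pi> h n = c * path_sum \<phi> \<pi> h n"
  by (simp add: path_sum_def sum_distrib_left)

locale discounted_environment =
  fixes \<xi> :: "('a::finite, 'e::finite) environment" and \<gamma> :: "nat \<Rightarrow> real" and \<rho> :: "'e \<Rightarrow> real"
  assumes nonneg: "0 \<le> \<xi> h"
    and chronological: "(\<Sum>e\<in>UNIV. \<xi> (h @ [(a, e)])) \<le> \<xi> h"
    and discount_nonneg: "0 \<le> \<gamma> k"
    and discount_summable: "summable \<gamma>"
    and reward_nonneg: "0 \<le> \<rho> e"
    and reward_le_1: "\<rho> e \<le> 1"
begin

lemma discount_tail_eq: "discount_tail \<gamma> t = \<gamma> t + discount_tail \<gamma> (Suc t)"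
  using suminf_split_head[of "\<lambda>j. \<gamma> (t + j)"] discount_summable
  by (simp add: discount_tail_def summable_iff_shift add.commute[of t])

lemma discount_tail_nonneg: "0 \<le> discount_tail \<gamma> t"
  unfolding discount_tail_def using discount_summable discount_nonneg
  by (intro suminf_nonneg) (simp_all add: add.commute[of t] summable_iff_shift)

lemma discount_tail_tendsto_0: "discount_tail \<gamma> \<longlonglongrightarrow> 0"
proof -
  have "discount_tail \<gamma> t = suminf \<gamma> - sum \<gamma> {..<t}" for t
    using suminf_split_initial_segment[OF discount_summable, of t]
    by (simp add: discount_tail_def add.commute)
  then have "discount_tail \<gamma> = (\<lambda>t. suminf \<gamma> - sum \<gamma> {..<t})"
    by (rule ext)
  moreover have "(\<lambda>t. suminf \<gamma> - sum \<gamma> {..<t}) \<longlonglongrightarrow> suminf \<gamma> - suminf \<gamma>"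
    by (intro tendsto_diff tendsto_const summable_LIMSEQ discount_summable)
  ultimately show ?thesis
    by simp
qed

lemma path_sum_environment_le: "path_sum \<xi> \<pi> h n \<le> \<xi> h"
proof (induction n)
  case (Suc n)
  have "path_sum \<xi> \<pi> h (Suc n) \<le> path_sum \<xi> \<pi> h n"
    unfolding path_sum_Suc by (intro path_sum_mono chronological)
  with Suc show ?case by simp
qed simp

text \<open>The discounted reward of the last percept of \<open>h\<close>, whose time is
  \<open>length h\<close>, weighted by \<open>\<xi> h\<close> instead of a conditional probability.
  It enters \<open>total_gain\<close> at nonempty histories only. The value of a policy becomes a
  single quotient, in which the division can be postponed to the end.\<close>

definition gain :: "('a, 'e) history \<Rightarrow> real" where
  "gain h = \<gamma> (length h) * (\<rho> (snd (last h)) * \<xi> h)"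

definition total_gain :: "('a, 'e) policy \<Rightarrow> ('a, 'e) history \<Rightarrow> real" where
  "total_gain \<pi> h = (\<Sum>j. path_sum gain \<pi> h (Suc j))"

lemma gain_nonneg: "0 \<le> gain h"
  by (simp add: gain_def nonneg discount_nonneg reward_nonneg)

lemma gain_le: "gain h \<le> \<gamma> (length h) * \<xi> h"
  unfolding gain_def
  by (intro mult_left_mono mult_left_le_one_le nonneg discount_nonneg reward_nonneg reward_le_1)

lemma path_sum_gain_nonneg: "0 \<le> path_sum gain \<pi> h n"
  unfolding path_sum_def by (intro sum_nonneg gain_nonneg)

lemma path_sum_gain_le: "path_sum gain \<pi> h n \<le> \<gamma> (length h + n) * \<xi> h"
proof -
  have "path_sum gain \<pi> h n \<le> path_sum (\<lambda>h'. \<gamma> (length h + n) * \<xi> h') \<pi> h n"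
    by (intro path_sum_mono) (metis gain_le)
  also have "\<dots> \<le> \<gamma> (length h + n) * \<xi> h"
    unfolding path_sum_cmult by (intro mult_left_mono path_sum_environment_le discount_nonneg)
  finally show ?thesis .
qed

lemma summable_path_sum_gain: "summable (\<lambda>j. path_sum gain \<pi> h (Suc j))"
proof (rule summable_comparison_test')
  show "summable (\<lambda>j. \<gamma> (j + Suc (length h)) * \<xi> h)"
    using discount_summable by (intro summable_mult2) (simp only: summable_iff_shift)
  show "norm (path_sum gain \<pi> h (Suc j)) \<le> \<gamma> (j + Suc (length h)) * \<xi> h" for j
    using path_sum_gain_le[of \<pi> h "Suc j"] path_sum_gain_nonneg[of \<pi> h "Suc j"]
    by (simp add: add.commute)
qed

lemma policy_value_eq:
  "policy_value \<gamma> \<rho> \<xi> \<pi> h =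
    (if discount_tail \<gamma> (Suc (length h)) > 0
     then total_gain \<pi> h / (discount_tail \<gamma> (Suc (length h)) * \<xi> h) else 0)"
proof -
  have "\<gamma> (length h + 1 + j) * (\<Sum>es\<in>{es. length es = j + 1}. \<rho> (last es) * (\<xi> (extend \<pi> h es) / \<xi> h))
      = path_sum gain \<pi> h (Suc j) / \<xi> h" for j
    unfolding path_sum_def
    by (simp add: sum_lists_length_Suc gain_def sum_distrib_left sum_divide_distrib)
  then show ?thesis
    by (simp add: policy_value_def Let_def total_gain_def suminf_divide summable_path_sum_gain)
qed

text \<open>A supersolution of the Bellman equation dominates every policy: \<open>n\<close>
  applications of the second hypothesis bound the first \<open>n\<close> gains plus a remainder by
  \<open>\<phi> h\<close>, and the remainder is nonnegative.\<close>

lemma total_gain_le: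
  assumes "\<And>h. 0 \<le> \<phi> h"
    and "\<And>h a. (\<Sum>e\<in>UNIV. gain (h @ [(a, e)]) + \<phi> (h @ [(a, e)])) \<le> \<phi> h"
  shows "total_gain \<pi> h \<le> \<phi> h"
proof -
  have *: "(\<Sum>j<n. path_sum gain \<pi> h (Suc j)) + path_sum \<phi> \<pi> h n \<le> \<phi> h" for n
  proof (induction n)
    case (Suc n)
    have "path_sum gain \<pi> h (Suc n) + path_sum \<phi> \<pi> h (Suc n) \<le> path_sum \<phi> \<pi> h n"
      unfolding path_sum_add[symmetric] path_sum_Suc by (intro path_sum_mono assms(2)[unfolded sum.distrib])
    with Suc show ?case by simp
  qed simp
  moreover have "0 \<le> path_sum \<phi> \<pi> h n" for n
    unfolding path_sum_def by (intro sum_nonneg assms(1))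
  ultimately have "(\<Sum>j<n. path_sum gain \<pi> h (Suc j)) \<le> \<phi> h" for n
    by (metis add_increasing2 order.trans order.refl)
  then show ?thesis
    unfolding total_gain_def by (intro suminf_le_const summable_path_sum_gain)
qed

text \<open>Dually, a subsolution along the actions of \<open>\<pi>\<close> is a lower bound. Here
  the remainder after \<open>n\<close> steps must not stay positive in the limit; the first
  hypothesis bounds it by a discount tail times \<open>\<xi> h\<close>, which tends to 0.\<close>

lemma total_gain_ge:
  assumes "\<And>h. \<psi> h \<le> discount_tail \<gamma> (Suc (length h)) * \<xi> h"
    and "\<And>h. \<psi> h \<le> (\<Sum>e\<in>UNIV. gain (h @ [(\<pi> h, e)]) + \<psi> (h @ [(\<pi> h, e)]))"
  shows "\<psi> h \<le> total_gain \<pi> h"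
proof -
  have *: "\<psi> h \<le> (\<Sum>j<n. path_sum gain \<pi> h (Suc j)) + path_sum \<psi> \<pi> h n" for n
  proof (induction n)
    case (Suc n)
    have "path_sum \<psi> \<pi> h n \<le> path_sum gain \<pi> h (Suc n) + path_sum \<psi> \<pi> h (Suc n)"
      unfolding path_sum_add[symmetric] path_sum_Suc by (intro path_sum_mono assms(2)[unfolded sum.distrib])
    with Suc show ?case by simp
  qed simp
  have "path_sum \<psi> \<pi> h n \<le> discount_tail \<gamma> (n + Suc (length h)) * \<xi> h" for n
  proof -
    have "path_sum \<psi> \<pi> h n \<le> path_sum (\<lambda>h'. discount_tail \<gamma> (n + Suc (length h)) * \<xi> h') \<pi> h n"
      using assms(1) by (intro path_sum_mono) (metis add.commute add_Suc_right)
    also have "\<dots> \<le> discount_tail \<gamma> (n + Suc (length h)) * \<xi> h"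
      unfolding path_sum_cmult by (intro mult_left_mono path_sum_environment_le discount_tail_nonneg)
    finally show ?thesis .
  qed
  with * have "\<psi> h \<le> (\<Sum>j<n. path_sum gain \<pi> h (Suc j)) + discount_tail \<gamma> (n + Suc (length h)) * \<xi> h" for n
    by (meson add_left_mono order.trans)
  moreover have "(\<lambda>n. (\<Sum>j<n. path_sum gain \<pi> h (Suc j)) + discount_tail \<gamma> (n + Suc (length h)) * \<xi> h)
      \<longlonglongrightarrow> total_gain \<pi> h + 0 * \<xi> h"
    unfolding total_gain_def
    by (intro tendsto_intros summable_LIMSEQ summable_path_sum_gain
        LIMSEQ_ignore_initial_segment[OF discount_tail_tendsto_0])
  ultimately show ?thesis
    by (intro LIMSEQ_le_const[where a = "\<psi> h"]) auto
qed

text \<open>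
  The errors are multiplicative: a policy that loses at most the fraction \<open>\<eta> / 2 ^ (t + 1)\<close> of
  the optimal value at time \<open>t\<close> retains the fraction \<open>1 - \<eta>\<close> of it overall.
\<close>

lemma policy_value_near_optimal:
  assumes g: "\<And>h. g h \<le> gain h" "\<And>h. gain h \<le> g h + \<delta> * (\<gamma> (length h) * \<xi> h)" "\<And>h. 0 \<le> g h"
    and W: "\<And>h. 0 \<le> W h" "\<And>h. W h \<le> discount_tail \<gamma> (Suc (length h)) * \<xi> h"
    and bellman: "\<And>h a. (\<Sum>e\<in>UNIV. g (h @ [(a, e)]) + W (h @ [(a, e)])) \<le> W h"
    and \<pi>: "\<And>h. (1 - \<eta> / 2 ^ Suc (length h)) * W h
      \<le> (\<Sum>e\<in>UNIV. g (h @ [(\<pi> h, e)]) + W (h @ [(\<pi> h, e)]))"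
    and "0 \<le> \<delta>" "0 \<le> \<eta>" "\<eta> \<le> 1"
  shows "policy_value \<gamma> \<rho> \<xi> \<pi>' h \<le> policy_value \<gamma> \<rho> \<xi> \<pi> h + (\<eta> + \<delta>)"
proof -
  \<comment> \<open>The factor by which gains are normalised. It is itself a supersolution for the
    constant reward 1, so it absorbs the rounding errors of all later times at once.\<close>
  define \<Gamma> where "\<Gamma> h = discount_tail \<gamma> (Suc (length h)) * \<xi> h" for h
  have \<Gamma>_nonneg: "0 \<le> \<Gamma> h" for h
    by (simp add: \<Gamma>_def nonneg discount_tail_nonneg)
  have \<Gamma>_step: "(\<Sum>e\<in>UNIV. \<gamma> (Suc (length h)) * \<xi> (h @ [(a, e)]) + \<Gamma> (h @ [(a, e)])) \<le> \<Gamma> h" for h a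
  proof -
    have "(\<Sum>e\<in>UNIV. \<gamma> (Suc (length h)) * \<xi> (h @ [(a, e)]) + \<Gamma> (h @ [(a, e)]))
        = discount_tail \<gamma> (Suc (length h)) * (\<Sum>e\<in>UNIV. \<xi> (h @ [(a, e)]))"
      by (simp add: \<Gamma>_def discount_tail_eq[of "Suc (length h)"] sum_distrib_left algebra_simps)
    also have "\<dots> \<le> \<Gamma> h"
      unfolding \<Gamma>_def by (intro mult_left_mono chronological discount_tail_nonneg)
    finally show ?thesis .
  qed
  \<comment> \<open>\<open>W\<close> pays for the rounded gains and
    \<open>\<delta> * \<Gamma>\<close> for the rounding, so the sum is a supersolution for the true
    gains.\<close>
  have upper: "total_gain \<pi>' h \<le> W h + \<delta> * \<Gamma> h"
  proof (rule total_gain_le)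
    show "0 \<le> W h + \<delta> * \<Gamma> h" for h
      using W(1) \<Gamma>_nonneg \<open>0 \<le> \<delta>\<close> by simp
    fix h a
    have "(\<Sum>e\<in>UNIV. gain (h @ [(a, e)]) + (W (h @ [(a, e)]) + \<delta> * \<Gamma> (h @ [(a, e)])))
      \<le> (\<Sum>e\<in>UNIV. (g (h @ [(a, e)]) + W (h @ [(a, e)])) +
          \<delta> * (\<gamma> (Suc (length h)) * \<xi> (h @ [(a, e)]) + \<Gamma> (h @ [(a, e)])))"
      using g(2)[of "h @ [(a, _)]"] by (intro sum_mono) (simp add: algebra_simps)
    also have "\<dots> = (\<Sum>e\<in>UNIV. g (h @ [(a, e)]) + W (h @ [(a, e)])) +
        \<delta> * (\<Sum>e\<in>UNIV. \<gamma> (Suc (length h)) * \<xi> (h @ [(a, e)]) + \<Gamma> (h @ [(a, e)]))"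
      by (subst sum.distrib) (simp only: sum_distrib_left)
    also have "\<dots> \<le> W h + \<delta> * \<Gamma> h"
      by (intro add_mono mult_left_mono bellman \<Gamma>_step \<open>0 \<le> \<delta>\<close>)
    finally show "(\<Sum>e\<in>UNIV. gain (h @ [(a, e)]) + (W (h @ [(a, e)]) + \<delta> * \<Gamma> (h @ [(a, e)])))
      \<le> W h + \<delta> * \<Gamma> h" .
  qed
  define p where "p h = 1 - \<eta> / 2 ^ length h" for h :: "('a, 'e) history"
  have p: "0 \<le> p h" "p h \<le> 1" for h
  proof -
    have "(1::real) \<le> 2 ^ length h"
      by simp
    with \<open>\<eta> \<le> 1\<close> have "\<eta> \<le> 2 ^ length h"
      by linarith
    then show "0 \<le> p h" "p h \<le> 1"
      using \<open>0 \<le> \<eta>\<close> by (simp_all add: p_def divide_le_eq)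
  qed
  have lower: "p h * W h \<le> total_gain \<pi> h" for h
  proof (rule total_gain_ge)
    show "p h * W h \<le> discount_tail \<gamma> (Suc (length h)) * \<xi> h" for h
      using mult_left_le_one_le[OF W(1) p, of h h] W(2)[of h] by linarith
    fix h :: "('a, 'e) history"
    \<comment> \<open>\<open>x\<close> is the fraction that may be lost at \<open>h\<close>. One
      factor \<open>1 - x\<close> accounts for this loss and another one is the weight
      \<open>p\<close> of the children; the halving in \<open>p\<close> gives
      \<open>p h = 1 - 2 * x\<close>, which is at most \<open>(1 - x) * (1 - x)\<close>.\<close>
    define x where "x = \<eta> / 2 ^ Suc (length h)"
    have px: "p (h @ [(\<pi> h, e)]) = 1 - x" for e
      by (simp add: p_def x_def)
    have "0 \<le> 1 - x"
      using p(1)[of "h @ [(\<pi> h, undefined)]"] by (simp add: px)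
    have "p h = 1 - 2 * x"
      by (simp add: p_def x_def)
    also have "\<dots> \<le> (1 - x) * (1 - x)"
      by (simp add: algebra_simps)
    finally have "p h * W h \<le> (1 - x) * ((1 - x) * W h)"
      using W(1)[of h] mult_right_mono by (simp add: mult.assoc[symmetric] mult_right_mono)
    also have "\<dots> \<le> (1 - x) * (\<Sum>e\<in>UNIV. g (h @ [(\<pi> h, e)]) + W (h @ [(\<pi> h, e)]))"
      using \<open>0 \<le> 1 - x\<close> \<pi>[of h] by (intro mult_left_mono) (simp_all add: x_def)
    also have "\<dots> = (\<Sum>e\<in>UNIV. (1 - x) * g (h @ [(\<pi> h, e)]) + (1 - x) * W (h @ [(\<pi> h, e)]))"
      by (simp add: sum_distrib_left distrib_left)
    also have "\<dots> \<le> (\<Sum>e\<in>UNIV. gain (h @ [(\<pi> h, e)]) + p (h @ [(\<pi> h, e)]) * W (h @ [(\<pi> h, e)]))"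
    proof (intro sum_mono add_mono)
      fix e
      have "(1 - x) * g (h @ [(\<pi> h, e)]) \<le> g (h @ [(\<pi> h, e)])"
        using \<open>0 \<le> 1 - x\<close> \<open>0 \<le> \<eta>\<close> by (intro mult_left_le_one_le g(3)) (simp_all add: x_def)
      then show "(1 - x) * g (h @ [(\<pi> h, e)]) \<le> gain (h @ [(\<pi> h, e)])"
        using g(1) order.trans by blast
    qed (simp add: px)
    finally show "p h * W h
      \<le> (\<Sum>e\<in>UNIV. gain (h @ [(\<pi> h, e)]) + p (h @ [(\<pi> h, e)]) * W (h @ [(\<pi> h, e)]))" .
  qed
  show ?thesis
  proof (cases "discount_tail \<gamma> (Suc (length h)) > 0 \<and> \<xi> h > 0")
    case True
    then have pos: "0 < \<Gamma> h"
      by (simp add: \<Gamma>_def)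
    have "1 - \<eta> \<le> p h"
      using \<open>0 \<le> \<eta>\<close> by (simp add: p_def divide_le_eq mult_le_cancel_left1)
    then have "(1 - \<eta>) * W h \<le> total_gain \<pi> h"
      using lower[of h] W(1)[of h] by (meson mult_right_mono order.trans)
    moreover have "\<eta> * W h \<le> \<eta> * \<Gamma> h"
      using W(2)[of h] \<open>0 \<le> \<eta>\<close> unfolding \<Gamma>_def by (rule mult_left_mono)
    ultimately have "total_gain \<pi>' h \<le> total_gain \<pi> h + (\<eta> + \<delta>) * \<Gamma> h"
      using upper by (simp add: algebra_simps)
    then have "total_gain \<pi>' h / \<Gamma> h \<le> total_gain \<pi> h / \<Gamma> h + (\<eta> + \<delta>)"
      using pos by (simp add: field_simps)
    with True show ?thesis
      by (simp add: policy_value_eq \<Gamma>_def)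
  next
    \<comment> \<open>The normalising factor degenerates, and every policy has value 0 by convention
      or through division by zero.\<close>
    case False
    then have "discount_tail \<gamma> (Suc (length h)) \<le> 0 \<or> \<xi> h = 0"
      using nonneg[of h] by (simp add: not_less order.antisym)
    then have "policy_value \<gamma> \<rho> \<xi> \<pi> h = 0" for \<pi>
      unfolding policy_value_eq by auto
    with \<open>0 \<le> \<eta>\<close> \<open>0 \<le> \<delta>\<close> show ?thesis by simp
  qed
qed

end

section \<open>Backward induction in stages\<close>

definition child_code :: "nat \<Rightarrow> nat \<Rightarrow> nat \<Rightarrow> nat" where
  "child_code n a e = Suc (prod_encode (prod_encode (a, e), n))"

text \<open>Backward induction can therefore run downwards through the codes, starting from the
  cut-off, and \<open>s - n\<close> is a measure for inductions over the histories below it.\<close>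

lemma child_code_gt: "n < child_code n a e"
  by (simp add: child_code_def le_prod_encode_2 less_Suc_eq_le)

lemma recursive_child_code [recursive_intros]:
  "recursive n \<Longrightarrow> recursive a \<Longrightarrow> recursive e \<Longrightarrow> recursive (\<lambda>x. child_code (n x) (a x) (e x))"
  unfolding child_code_def by (intro recursive_intros)

text \<open>
  \<open>value_table A E g s k\<close> codes the list of the values at \<open>s - k, \<dots>, s - 1\<close>, where the value at
  codes from \<open>s\<close> on is 0; \<open>A\<close> and \<open>E\<close> are the numbers of actions and percepts.
\<close>

primrec value_table ::
  "nat \<Rightarrow> nat \<Rightarrow> (nat \<Rightarrow> nat \<Rightarrow> nat \<Rightarrow> nat) \<Rightarrow> nat \<Rightarrow> nat \<Rightarrow> nat" where
  "value_table A E g s 0 = 0"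
| "value_table A E g s (Suc k) = Suc (prod_encode
    (max_below A (\<lambda>a. \<Sum>e<E. g (s - Suc k) a e +
        nth_code (value_table A E g s k) (child_code (s - Suc k) a e - (s - k))),
     value_table A E g s k))"

definition stage_value ::
  "nat \<Rightarrow> nat \<Rightarrow> (nat \<Rightarrow> nat \<Rightarrow> nat \<Rightarrow> nat) \<Rightarrow> nat \<Rightarrow> nat \<Rightarrow> nat" where
  "stage_value A E g s n = nth_code (value_table A E g s s) n"

definition stage_action_value ::
  "nat \<Rightarrow> nat \<Rightarrow> (nat \<Rightarrow> nat \<Rightarrow> nat \<Rightarrow> nat) \<Rightarrow> nat \<Rightarrow> nat \<Rightarrow> nat \<Rightarrow> nat" where
  "stage_action_value A E g s n a = (\<Sum>e<E. g n a e + stage_value A E g s (child_code n a e))"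

text \<open>Each round puts one entry in front, so an earlier table is a tail of every later one.
  Entries of the partial tables used in the recursion are thereby entries of the complete
  table.\<close>

lemma nth_code_value_table:
  "nth_code (value_table A E g s (i + k)) (i + j) = nth_code (value_table A E g s k) j"
  by (induction i) simp_all

text \<open>The table turns a recursion towards larger codes into a primitive recursion on the
  distance to \<open>s\<close>; here the Bellman recursion with cut-off is recovered from
  it.\<close>

lemma stage_value_eq:
  "stage_value A E g s n = (if n < s then max_below A (stage_action_value A E g s n) else 0)"
proof (cases "n < s")
  case True
  define k where "k = s - Suc n"
  have s: "s = n + Suc k" and n: "s - Suc k = n" "s - k = Suc n"
    using True by (auto simp: k_def)
  \<comment> \<open>The partial table begins with the entry for code \<open>Suc n\<close>, and this
    offset is subtracted from the code of the child, which is at least as large.\<close>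
  have child: "nth_code (value_table A E g s k) (child_code n a e - Suc n)
      = stage_value A E g s (child_code n a e)" for a e
    using nth_code_value_table[of A E g s "Suc n" k "child_code n a e - Suc n"]
      child_code_gt[of n a e] s by (simp add: stage_value_def)
  have "stage_value A E g s n = nth_code (value_table A E g s (Suc k)) 0"
    using nth_code_value_table[of A E g s n "Suc k" 0] s by (simp add: stage_value_def)
  also have "\<dots> = max_below A (stage_action_value A E g s n)"
    by (simp only: value_table.simps nth_code_Suc n child stage_action_value_def[abs_def])
  finally show ?thesis
    using True by simp
next
  case False
  then show ?thesis
    using nth_code_value_table[of A E g s s 0 "n - s"] by (simp add: stage_value_def)
qed

lemma recursive_stage_value [recursive_intros]:
  assumes "\<And>a b c d. recursive a \<Longrightarrow> recursive b \<Longrightarrow> recursive c \<Longrightarrow> recursive d \<Longrightarrow>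
      recursive (\<lambda>x. g (a x) (b x) (c x) (d x))"
    and "recursive s" "recursive n"
  shows "recursive (\<lambda>x. stage_value A E (g (s x)) (s x) (n x))"
proof -
  have "recursive (\<lambda>x. nth_code (rec_nat 0 (\<lambda>k v. Suc (prod_encode
      (max_below A (\<lambda>a. \<Sum>e<E. g (s x) (s x - Suc k) a e +
        nth_code v (child_code (s x - Suc k) a e - (s x - k))), v))) (s x)) (n x))"
    by (intro recursive_intros assms recursive_comp[OF assms(2)])
  moreover have "rec_nat 0 (\<lambda>k v. Suc (prod_encode
      (max_below A (\<lambda>a. \<Sum>e<E. g s (s - Suc k) a e +
        nth_code v (child_code (s - Suc k) a e - (s - k))), v))) k = value_table A E (g s) s k" for s k
    by (induction k) simp_all
  ultimately show ?thesis
    by (simp add: stage_value_def)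
qed

lemma recursive_stage_action_value [recursive_intros]:
  assumes "\<And>a b c d. recursive a \<Longrightarrow> recursive b \<Longrightarrow> recursive c \<Longrightarrow> recursive d \<Longrightarrow>
      recursive (\<lambda>x. g (a x) (b x) (c x) (d x))"
    and "recursive s" "recursive n" "recursive a"
  shows "recursive (\<lambda>x. stage_action_value A E (g (s x)) (s x) (n x) (a x))"
  unfolding stage_action_value_def
  by (intro recursive_intros assms recursive_comp[OF assms(2)] recursive_comp[OF assms(3)]
      recursive_comp[OF assms(4)])

lemma sum_mult_le:
  fixes f g :: "nat \<Rightarrow> nat"
  shows "(\<And>e. e < E \<Longrightarrow> c * f e \<le> g e) \<Longrightarrow> c * (\<Sum>e<E. f e) \<le> (\<Sum>e<E. g e)"
  unfolding sum_distrib_left by (rule sum_mono) simp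

text \<open>Moving the cut-off replaces zeros by nonnegative values, and the action that is best at
  stage \<open>s\<close> still competes at stage \<open>Suc s\<close>. The factor \<open>c\<close>
  is the ratio of the denominators of the two stages.\<close>

lemma stage_value_mono:
  assumes "\<And>s n a e. c * g s n a e \<le> g (Suc s) n a e"
  shows "c * stage_value A E (g s) s n \<le> stage_value A E (g (Suc s)) (Suc s) n"
proof (induction "s - n" arbitrary: n rule: less_induct)
  case less
  show ?case
  proof (cases "n < s \<and> 0 < A")
    case True
    define a where "a = argmax_below A (stage_action_value A E (g s) s n)"
    have a: "a < A" "max_below A (stage_action_value A E (g s) s n) = stage_action_value A E (g s) s n a"
      using argmax_below[of A] True by (auto simp: a_def)
    have "c * stage_value A E (g s) s n = c * stage_action_value A E (g s) s n a"
      using True a(2) by (simp add: stage_value_eq[of _ _ _ s n])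
    also have "\<dots> \<le> stage_action_value A E (g (Suc s)) (Suc s) n a"
      unfolding stage_action_value_def
    proof (rule sum_mult_le)
      fix e
      have "s - child_code n a e < s - n"
        using True child_code_gt[of n a e] by linarith
      then have "c * stage_value A E (g s) s (child_code n a e)
          \<le> stage_value A E (g (Suc s)) (Suc s) (child_code n a e)"
        by (rule less)
      then show "c * (g s n a e + stage_value A E (g s) s (child_code n a e))
          \<le> g (Suc s) n a e + stage_value A E (g (Suc s)) (Suc s) (child_code n a e)"
        using assms[of s n a e] by (simp add: distrib_left add_mono)
    qed
    also have "\<dots> \<le> stage_value A E (g (Suc s)) (Suc s) n"
      using True max_below_ge[OF a(1)] by (simp add: stage_value_eq[of _ _ _ "Suc s" n])
    finally show ?thesis .
  next
    case False
    then show ?thesis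
      by (auto simp: stage_value_eq[of _ _ _ s n])
  qed
qed

text \<open>
  Changing the action only when it is no longer good enough makes the choice converge, even if
  several actions are optimal.
\<close>

primrec stage_choice ::
  "nat \<Rightarrow> nat \<Rightarrow> (nat \<Rightarrow> nat \<Rightarrow> nat \<Rightarrow> nat \<Rightarrow> nat) \<Rightarrow> nat \<Rightarrow> nat \<Rightarrow> nat \<Rightarrow> nat" where
  "stage_choice A E g C n 0 = 0"
| "stage_choice A E g C n (Suc s) =
    (if (C - 1) * stage_value A E (g s) s n
        \<le> C * stage_action_value A E (g s) s n (stage_choice A E g C n s)
     then stage_choice A E g C n s else argmax_below A (stage_action_value A E (g s) s n))"

lemma recursive_stage_choice:
  assumes "\<And>a b c d. recursive a \<Longrightarrow> recursive b \<Longrightarrow> recursive c \<Longrightarrow> recursive d \<Longrightarrow>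
      recursive (\<lambda>x. g (a x) (b x) (c x) (d x))"
    and "recursive C" "recursive n" "recursive s"
  shows "recursive (\<lambda>x. stage_choice A E g (C x) (n x) (s x))"
proof -
  have "recursive (\<lambda>x. rec_nat 0 (\<lambda>s v. if (C x - 1) * stage_value A E (g s) s (n x)
        \<le> C x * stage_action_value A E (g s) s (n x) v
     then v else argmax_below A (stage_action_value A E (g s) s (n x))) (s x))"
    by (intro recursive_intros assms recursive_comp[OF assms(2)] recursive_comp[OF assms(3)])
  moreover have "rec_nat 0 (\<lambda>s v. if (C - 1) * stage_value A E (g s) s n
        \<le> C * stage_action_value A E (g s) s n v
     then v else argmax_below A (stage_action_value A E (g s) s n)) s = stage_choice A E g C n s" for C n s
    by (induction s) simp_all
  ultimately show ?thesis by simp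
qed

lemma stage_choice_less: "0 < A \<Longrightarrow> stage_choice A E g C n s < A"
  by (induction s) (simp_all add: argmax_below)

text \<open>Suppose \<open>w > 0\<close> and \<open>W s1 > (1 - c) * w\<close>. An action adopted at
  stage \<open>s1\<close> has value at least \<open>W s1\<close> there, its value never decreases,
  and the threshold \<open>(1 - c) * W s\<close> never exceeds \<open>(1 - c) * w\<close>; so it is
  never given up. Hence at most one switch happens once \<open>W\<close> has passed
  \<open>(1 - c) * w\<close>. If \<open>w = 0\<close>, all \<open>W s\<close> vanish and every
  action passes the test.\<close>

lemma stable_choice:
  fixes W :: "nat \<Rightarrow> real" and Q :: "nat \<Rightarrow> nat \<Rightarrow> real" and b m :: "nat \<Rightarrow> nat"
  assumes b: "\<And>s. b (Suc s) = (if (1 - c) * W s \<le> Q s (b s) then b s else m s)"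
    and Q: "\<And>s a. 0 \<le> Q s a" "\<And>a. incseq (\<lambda>s. Q s a)"
    and m: "\<And>s. W s \<le> Q s (m s)"
    and W: "\<And>s. 0 \<le> W s" "incseq W" "W \<longlonglongrightarrow> w"
    and c: "0 < c" "c \<le> 1"
  obtains S where "\<And>s. S \<le> s \<Longrightarrow> b s = b S" "\<And>s. S \<le> s \<Longrightarrow> (1 - c) * W s \<le> Q s (b S)"
proof -
  have W_le: "W s \<le> w" for s
    using W(2,3) by (rule incseq_le)
  have "\<exists>S. \<forall>s\<ge>S. (1 - c) * W s \<le> Q s (b s)"
  proof (cases "w = 0")
    case True
    then have "W s = 0" for s
      using W(1)[of s] W_le[of s] by simp
    with Q(1) show ?thesis by simp
  next
    case False
    then have "(1 - c) * w < w"
      using c W(1)[of 0] W_le[of 0] by (simp add: algebra_simps)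
    then have "\<forall>\<^sub>F s in sequentially. (1 - c) * w < W s"
      using W(3) by (rule order_tendstoD(1)[rotated])
    then obtain S where S: "\<And>s. S \<le> s \<Longrightarrow> (1 - c) * w < W s"
      by (auto simp: eventually_sequentially)
    show ?thesis
    proof (cases "\<forall>s\<ge>S. (1 - c) * W s \<le> Q s (b s)")
      case False
      then obtain s1 where s1: "S \<le> s1" "\<not> (1 - c) * W s1 \<le> Q s1 (b s1)"
        by auto
      have good: "(1 - c) * W s \<le> Q s (m s1)" if "s1 \<le> s" for s
      proof -
        have "(1 - c) * W s \<le> (1 - c) * w"
          using W_le c by (intro mult_left_mono) auto
        also have "\<dots> \<le> W s1"
          using S[OF s1(1)] by simp
        also have "\<dots> \<le> Q s1 (m s1)"
          by (rule m)
        also have "\<dots> \<le> Q s (m s1)"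
          using Q(2) that by (rule incseqD)
        finally show ?thesis .
      qed
      have "b s = m s1" if "Suc s1 \<le> s" for s
        using that
      proof (induction rule: dec_induct)
        case base
        then show ?case
          using s1(2) b[of s1] by simp
      next
        case (step s)
        then show ?case
          using b[of s] good[of s] by simp
      qed
      then have "\<forall>s\<ge>Suc s1. (1 - c) * W s \<le> Q s (b s)"
        using good by simp
      then show ?thesis
        by blast
    qed blast
  qed
  then obtain S where S: "\<And>s. S \<le> s \<Longrightarrow> (1 - c) * W s \<le> Q s (b s)"
    by blast
  have const: "b s = b S" if "S \<le> s" for s
    using that
  proof (induction rule: dec_induct)
    case (step s)
    then show ?case
      using b[of s] S[of s] by simp
  qed simp
  show ?thesis
  proof (rule that[of S])
    show "b s = b S" if "S \<le> s" for s
      by (rule const[OF that])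
    show "(1 - c) * W s \<le> Q s (b S)" if "S \<le> s" for s
      using S[OF that] const[OF that] by simp
  qed
qed

section \<open>Coding of histories\<close>

lemma finite_code_bij: "bij_betw (finite_code :: 'x::finite \<Rightarrow> nat) UNIV {..<CARD('x)}"
proof -
  have "\<exists>f :: 'x \<Rightarrow> nat. bij_betw f UNIV {..<CARD('x)}"
    using ex_bij_betw_finite_nat[of "UNIV :: 'x set"] by (simp add: atLeast0LessThan)
  then show ?thesis
    unfolding finite_code_def by (rule someI_ex)
qed

lemma finite_code_inj [simp]: "finite_code x = finite_code y \<longleftrightarrow> x = y"
  using finite_code_bij by (metis bij_betw_def inj_eq)

lemma finite_code_less: "finite_code (x :: 'x::finite) < CARD('x)"
  using finite_code_bij[where 'x='x] by (metis bij_betw_apply UNIV_I lessThan_iff)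

lemma finite_code_surj: "n < CARD('x::finite) \<Longrightarrow> \<exists>x :: 'x. finite_code x = n"
  using finite_code_bij[where 'x='x] unfolding bij_betw_def by (metis imageE lessThan_iff)

lemma sum_finite_code: "(\<Sum>e<CARD('e::finite). f e) = (\<Sum>e\<in>UNIV. f (finite_code (e :: 'e)))"
  using sum.reindex_bij_betw[OF finite_code_bij[where 'x='e], of f] by simp

definition pair_code :: "'a::finite \<times> 'e::finite \<Rightarrow> nat" where
  "pair_code = (\<lambda>(a, e). prod_encode (finite_code a, finite_code e))"

lemma history_code_eq: "history_code h = list_encode (map pair_code h)"
  by (simp add: history_code_def pair_code_def)

lemma inj_history_code: "inj (history_code :: ('a::finite, 'e::finite) history \<Rightarrow> nat)"
proof (rule injI)
  fix h h' :: "('a, 'e) history"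
  assume "history_code h = history_code h'"
  moreover have "inj (pair_code :: 'a \<times> 'e \<Rightarrow> nat)"
    by (auto intro!: injI simp: pair_code_def)
  ultimately show "h = h'"
    by (simp add: history_code_eq inj_eq[OF inj_list_encode] inj_map_eq_map)
qed

text \<open>
  Histories are also coded in reverse order, so that appending an interaction becomes the
  arithmetic operation \<open>child_code\<close>.
\<close>

definition reverse_history_code :: "('a::finite, 'e::finite) history \<Rightarrow> nat" where
  "reverse_history_code h = list_encode (map pair_code (rev h))"

lemma rev_code_history_code [simp]:
  "rev_code (history_code h) = reverse_history_code h"
  "rev_code (reverse_history_code h) = history_code h"
  by (simp_all add: history_code_eq reverse_history_code_def rev_map)

lemma length_code_reverse_history_code [simp]: "length_code (reverse_history_code h) = length h"
  by (simp add: reverse_history_code_def)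

lemma child_code_reverse_history_code [simp]:
  "child_code (reverse_history_code h) (finite_code a) (finite_code e)
    = reverse_history_code (h @ [(a, e)])"
  by (simp add: reverse_history_code_def child_code_def pair_code_def)

text \<open>The graph of a policy contains codes of genuine histories only, so its limit function
  must recognise all other numbers. The accumulator stays 1 as long as both components of every
  entry are in range.\<close>

definition valid_code :: "nat \<Rightarrow> nat \<Rightarrow> nat \<Rightarrow> nat" where
  "valid_code A E c = fold_code (\<lambda>p v. if Suc (fst (prod_decode p)) \<le> A
    then (if Suc (snd (prod_decode p)) \<le> E then v else 0) else 0) c 1"

lemma valid_code_eq_1:
  "valid_code CARD('a::finite) CARD('e::finite) c = 1 \<longleftrightarrow> (\<exists>h :: ('a, 'e) history. c = history_code h)"
proof -
  define g where "g p v = (if Suc (fst (prod_decode p)) \<le> CARD('a)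
    then (if Suc (snd (prod_decode p)) \<le> CARD('e) then v else 0) else 0)" for p v :: nat
  have pair: "fst (prod_decode p) < CARD('a) \<and> snd (prod_decode p) < CARD('e)
      \<longleftrightarrow> p \<in> range (pair_code :: 'a \<times> 'e \<Rightarrow> nat)" for p
  proof
    assume "fst (prod_decode p) < CARD('a) \<and> snd (prod_decode p) < CARD('e)"
    then obtain a :: 'a and e :: 'e
      where "finite_code a = fst (prod_decode p)" "finite_code e = snd (prod_decode p)"
      using finite_code_surj by metis
    then have "p = pair_code (a, e)"
      by (simp add: pair_code_def)
    then show "p \<in> range (pair_code :: 'a \<times> 'e \<Rightarrow> nat)"
      by blast
  qed (auto simp: pair_code_def finite_code_less)
  have fold: "fold g xs v = (if set xs \<subseteq> range (pair_code :: 'a \<times> 'e \<Rightarrow> nat) then v else 0)" for xs v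
    by (induction xs arbitrary: v) (auto simp: g_def Suc_le_eq simp flip: pair)
  have "set xs \<subseteq> range (pair_code :: 'a \<times> 'e \<Rightarrow> nat) \<longleftrightarrow> (\<exists>h :: ('a, 'e) history. xs = map pair_code h)" for xs
    by (metis ex_map_conv image_subset_iff list.set_map rangeI subset_code(1) UNIV_I imageE)
  moreover obtain xs where c: "c = list_encode xs"
    by (metis list_decode_inverse)
  ultimately show ?thesis
    unfolding c valid_code_def g_def[symmetric] fold_code_list_encode fold history_code_eq
    by (simp add: inj_eq[OF inj_list_encode])
qed

lemma recursive_valid_code [recursive_intros]:
  "recursive c \<Longrightarrow> recursive (\<lambda>x. valid_code A E (c x))"
  unfolding valid_code_def by (intro recursive_fold_code recursive_intros)

text \<open>The passage from growth of integer numerators to growth of the real approximations;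
  \<open>d\<close> is the part of the denominator that is the same at all stages.\<close>

lemma incseq_scaled:
  fixes F :: "nat \<Rightarrow> nat"
  assumes "\<And>s. c * F s \<le> F (Suc s)" "0 < c" "0 < d"
  shows "incseq (\<lambda>s. F s / (real c ^ s * d))"
proof (rule incseq_SucI)
  fix s
  have "real (c * F s) \<le> real (F (Suc s))"
    using assms(1) by (simp only: of_nat_le_iff)
  then show "F s / (real c ^ s * d) \<le> F (Suc s) / (real c ^ Suc s * d)"
    using assms(2,3) by (simp add: field_simps)
qed

section \<open>The Bayesian mixture\<close>

lemma computable_enumeration_semimeasure:
  "computable_enumeration \<nu> \<Longrightarrow> chronological_semimeasure (\<nu> i)"
  unfolding computable_enumeration_def by (metis (mono_tags, lifting) mem_Collect_eq rangeI)

lemma summable_bayes_mixture: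
  assumes "computable_enumeration \<nu>" "lower_semicomputable_prior w"
  shows "summable (\<lambda>i. w i * \<nu> i h)"
proof (rule summable_comparison_test')
  show "summable w"
    using assms(2) by (simp add: lower_semicomputable_prior_def)
  fix i
  have "0 < w i" "0 \<le> \<nu> i h" "\<nu> i h \<le> 1"
    using assms(2) computable_enumeration_semimeasure[OF assms(1), of i]
    by (auto simp: lower_semicomputable_prior_def chronological_semimeasure_def)
  then show "norm (w i * \<nu> i h) \<le> w i"
    by (simp add: mult_left_le)
qed

lemma bayes_mixture_nonneg:
  assumes "computable_enumeration \<nu>" "lower_semicomputable_prior w"
  shows "0 \<le> bayes_mixture w \<nu> h"
  unfolding bayes_mixture_def
proof (intro suminf_nonneg summable_bayes_mixture assms mult_nonneg_nonneg)
  show "0 \<le> w i" "0 \<le> \<nu> i h" for i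
    using assms(2) computable_enumeration_semimeasure[OF assms(1), of i]
    by (auto simp: lower_semicomputable_prior_def chronological_semimeasure_def less_imp_le)
qed

lemma bayes_mixture_chronological:
  assumes "computable_enumeration \<nu>" "lower_semicomputable_prior w"
  shows "(\<Sum>e\<in>UNIV. bayes_mixture w \<nu> (h @ [(a, e)])) \<le> bayes_mixture w \<nu> h"
proof -
  have "(\<Sum>e\<in>UNIV. bayes_mixture w \<nu> (h @ [(a, e)])) = (\<Sum>i. \<Sum>e\<in>UNIV. w i * \<nu> i (h @ [(a, e)]))"
    unfolding bayes_mixture_def by (intro suminf_sum[symmetric] summable_bayes_mixture assms)
  also have "\<dots> \<le> bayes_mixture w \<nu> h"
    unfolding bayes_mixture_def
  proof (intro suminf_le summable_sum summable_bayes_mixture assms)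
    fix i
    have "w i * (\<Sum>e\<in>UNIV. \<nu> i (h @ [(a, e)])) \<le> w i * \<nu> i h"
      using assms(2) computable_enumeration_semimeasure[OF assms(1), of i]
      by (intro mult_left_mono)
        (auto simp: lower_semicomputable_prior_def chronological_semimeasure_def less_imp_le)
    then show "(\<Sum>e\<in>UNIV. w i * \<nu> i (h @ [(a, e)])) \<le> w i * \<nu> i h"
      by (simp add: sum_distrib_left)
  qed
  finally show ?thesis .
qed

text \<open>Stage \<open>s\<close> keeps the terms \<open>i < s\<close> of the series and replaces
  both factors of each by their approximations over \<open>2 ^ s\<close>, whence
  \<open>4 ^ s\<close>. Term \<open>i\<close> is bounded by \<open>w i\<close> at every stage,
  because the approximations to the environments stay below 1; dominated convergence of series
  (Tannery) then gives the limit.\<close>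

lemma bayes_mixture_approx:
  fixes \<nu> :: "nat \<Rightarrow> ('a::finite, 'e::finite) environment"
  assumes "computable_enumeration \<nu>" "lower_semicomputable_prior w"
  obtains X :: "nat \<Rightarrow> nat \<Rightarrow> nat"
  where "recursive (\<lambda>y. X (fst (prod_decode y)) (snd (prod_decode y)))"
    and "\<And>s c. 4 * X s c \<le> X (Suc s) c"
    and "\<And>h. (\<lambda>s. X s (history_code h) / 4 ^ s) \<longlonglongrightarrow> bayes_mixture w \<nu> h"
proof -
  have semimeasure: "0 \<le> \<nu> i h" "\<nu> i h \<le> 1" for i h
    using computable_enumeration_semimeasure[OF assms(1), of i]
    by (auto simp: chronological_semimeasure_def)
  have w: "0 \<le> w i" "summable w" "lower_semicomputable id w" for i
    using assms(2) by (auto simp: lower_semicomputable_prior_def less_imp_le)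
  obtain F where F: "recursive (\<lambda>y. F (fst (prod_decode y)) (snd (prod_decode y)))"
    "\<And>s y. 2 * F s y \<le> F (Suc s) y" "\<And>s i. F s (id i) / 2 ^ s \<le> w i"
    "\<And>i. (\<lambda>s. F s (id i) / 2 ^ s) \<longlonglongrightarrow> w i"
    by (rule lower_semicomputable_approx[OF w(3) inj_on_id w(1)]) blast
  define code where "code = (\<lambda>(i, h :: ('a, 'e) history). prod_encode (i, history_code h))"
  have "lower_semicomputable code (\<lambda>(i, h). \<nu> i h)"
    using assms(1) unfolding computable_enumeration_def code_def by blast
  moreover have "inj code"
    unfolding code_def using inj_history_code by (auto intro!: injI dest: injD)
  moreover have "0 \<le> (case x of (i, h) \<Rightarrow> \<nu> i h)" for x
    by (simp add: split_def semimeasure)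
  ultimately obtain N where N: "recursive (\<lambda>y. N (fst (prod_decode y)) (snd (prod_decode y)))"
    "\<And>s y. 2 * N s y \<le> N (Suc s) y"
    "\<And>s x. N s (code x) / 2 ^ s \<le> (case x of (i, h) \<Rightarrow> \<nu> i h)"
    "\<And>x. (\<lambda>s. N s (code x) / 2 ^ s) \<longlonglongrightarrow> (case x of (i, h) \<Rightarrow> \<nu> i h)"
    by (rule lower_semicomputable_approx) blast+
  have N_le: "N s (prod_encode (i, history_code h)) / 2 ^ s \<le> 1"
    for s i and h :: "('a, 'e) history"
  proof -
    have "N s (prod_encode (i, history_code h)) / 2 ^ s \<le> \<nu> i h"
      using N(3)[of s "(i, h)"] by (simp add: code_def)
    also have "\<dots> \<le> 1"
      by (rule semimeasure)
    finally show ?thesis .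
  qed
  have N_lim: "(\<lambda>s. N s (prod_encode (i, history_code h)) / 2 ^ s) \<longlonglongrightarrow> \<nu> i h"
    for i and h :: "('a, 'e) history"
    using N(4)[of "(i, h)"] by (simp add: code_def)
  define X where "X s c = (\<Sum>i<s. F s i * N s (prod_encode (i, c)))" for s c
  have "recursive (\<lambda>y. X (fst (prod_decode y)) (snd (prod_decode y)))"
    unfolding X_def by (intro recursive_intros recursive_comp2[OF F(1)] recursive_comp2[OF N(1)])
  moreover have "4 * X s c \<le> X (Suc s) c" for s c
  proof -
    have "4 * X s c = (\<Sum>i<s. (2 * F s i) * (2 * N s (prod_encode (i, c))))"
      by (simp add: X_def sum_distrib_left mult.assoc mult.left_commute)
    also have "\<dots> \<le> (\<Sum>i<s. F (Suc s) i * N (Suc s) (prod_encode (i, c)))"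
      by (intro sum_mono mult_mono F(2) N(2)) auto
    also have "\<dots> \<le> X (Suc s) c"
      by (simp add: X_def)
    finally show ?thesis .
  qed
  moreover have "(\<lambda>s. X s (history_code h) / 4 ^ s) \<longlonglongrightarrow> bayes_mixture w \<nu> h" for h
  proof -
    define a where "a i s = (if i < s
      then F s i / 2 ^ s * (N s (prod_encode (i, history_code h)) / 2 ^ s) else 0)" for i s
    have "(\<lambda>s. a i s) \<longlonglongrightarrow> w i * \<nu> i h" for i
    proof -
      have "(\<lambda>s. F s i / 2 ^ s * (N s (prod_encode (i, history_code h)) / 2 ^ s)) \<longlonglongrightarrow> w i * \<nu> i h"
        using F(4)[of i] by (intro tendsto_mult N_lim) simp
      moreover have "\<forall>\<^sub>F s in sequentially.
          F s i / 2 ^ s * (N s (prod_encode (i, history_code h)) / 2 ^ s) = a i s"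
        using eventually_gt_at_top[of i] by eventually_elim (simp add: a_def)
      ultimately show ?thesis
        by (rule Lim_transform_eventually)
    qed
    moreover have "norm (a i s) \<le> w i" for i s
    proof (cases "i < s")
      case True
      have "F s i / 2 ^ s * (N s (prod_encode (i, history_code h)) / 2 ^ s) \<le> w i * 1"
        using F(3)[of s i] by (intro mult_mono N_le w(1)) simp_all
      with True show ?thesis
        by (simp add: a_def)
    qed (simp add: a_def w(1))
    then have "\<forall>\<^sub>F (i, s) in sequentially \<times>\<^sub>F sequentially. norm (a i s) \<le> w i"
      by (intro always_eventually) auto
    ultimately have "(\<lambda>s. \<Sum>i. a i s) \<longlonglongrightarrow> (\<Sum>i. w i * \<nu> i h)"
      using tannerys_theorem[of a "\<lambda>i. w i * \<nu> i h" sequentially w] w(2) by simp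
    moreover have "(\<Sum>i. a i s) = X s (history_code h) / 4 ^ s" for s
    proof -
      have "(\<Sum>i. a i s) = (\<Sum>i<s. a i s)"
        by (rule suminf_finite) (simp_all add: a_def)
      also have "\<dots> = (\<Sum>i<s. F s i * N s (prod_encode (i, history_code h)) / 4 ^ s)"
        by (intro sum.cong) (simp_all add: a_def flip: power_mult_distrib)
      also have "\<dots> = X s (history_code h) / 4 ^ s"
        by (simp add: X_def sum_divide_distrib)
      finally show ?thesis .
    qed
    ultimately show ?thesis
      by (simp add: bayes_mixture_def)
  qed
  ultimately show ?thesis
    by (rule that)
qed

section \<open>The limit computable policy\<close>

theorem corollary6p13:
  fixes reward :: "'e::finite \<Rightarrow> real"
    and \<nu> :: "nat \<Rightarrow> ('a::finite, 'e) environment"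
    and w \<gamma> :: "nat \<Rightarrow> real"
    and \<epsilon> :: real
  assumes "\<And>e. 0 \<le> reward e \<and> reward e \<le> 1"
    and "discount_function \<gamma>"
    and "computable_enumeration \<nu>"
    and "lower_semicomputable_prior w"
    and "\<epsilon> > 0"
  shows "\<exists>\<pi> :: ('a, 'e) policy.
    (\<forall>h. optimal_value \<gamma> reward (bayes_mixture w \<nu>) h
      - policy_value \<gamma> reward (bayes_mixture w \<nu>) \<pi> h < \<epsilon>) \<and>
    Delta02 (policy_graph_code \<pi>)"
proof -
  define \<xi> where "\<xi> = bayes_mixture w \<nu>"
  interpret discounted_environment \<xi> \<gamma> reward
    using assms(1,2) bayes_mixture_nonneg[OF assms(3,4)] bayes_mixture_chronological[OF assms(3,4)]
    by unfold_locales (auto simp: \<xi>_def discount_function_def)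
  \<comment> \<open>Tolerance and rounding will each cost \<open>1 / 2 ^ m\<close>, half of the
    admissible error.\<close>
  obtain m :: nat where "(1 / 2 :: real) ^ m < \<epsilon> / 2"
    using real_arch_pow_inv[of "\<epsilon> / 2" "1 / 2"] assms(5) by auto
  then have m: "2 / 2 ^ m < \<epsilon>"
    by (simp add: power_divide)
  define r where "r e = nat \<lfloor>2 ^ m * reward e\<rfloor>" for e
  have r: "real (r e) / 2 ^ m \<le> reward e" "reward e \<le> real (r e) / 2 ^ m + 1 / 2 ^ m" for e
  proof -
    have "real (r e) = \<lfloor>2 ^ m * reward e\<rfloor>"
      by (simp add: r_def reward_nonneg)
    then have "real (r e) \<le> 2 ^ m * reward e" "2 ^ m * reward e \<le> real (r e) + 1"
      by linarith+
    then show "real (r e) / 2 ^ m \<le> reward e" "reward e \<le> real (r e) / 2 ^ m + 1 / 2 ^ m"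
      by (simp_all add: field_simps)
  qed
  define R where "R k = (if k < CARD('e) then r (inv finite_code k) else 0)" for k
  have R_code: "R (finite_code e) = r e" for e :: 'e
    using finite_code_less[of e] by (simp add: R_def inv_f_f inj_def)
  have R_rec: "recursive R"
    by (rule recursive_finite_support[of "CARD('e)"]) (simp add: R_def)

  obtain D where D: "recursive (\<lambda>y. D (fst (prod_decode y)) (snd (prod_decode y)))"
    "\<And>s y. 2 * D s y \<le> D (Suc s) y" "\<And>s k. D s (id k) / 2 ^ s \<le> \<gamma> k"
    "\<And>k. (\<lambda>s. D s (id k) / 2 ^ s) \<longlonglongrightarrow> \<gamma> k"
    using assms(2)
    by (auto simp: discount_function_def computable_real_fun_def
        intro: lower_semicomputable_approx[of id \<gamma>])
  obtain X where X: "recursive (\<lambda>y. X (fst (prod_decode y)) (snd (prod_decode y)))"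
    "\<And>s c. 4 * X s c \<le> X (Suc s) c"
    "\<And>h. (\<lambda>s. X s (history_code h) / 4 ^ s) \<longlonglongrightarrow> \<xi> h"
    unfolding \<xi>_def by (rule bayes_mixture_approx[OF assms(3,4)]) blast
  \<comment> \<open>The numerator, over \<open>8 ^ s * 2 ^ m\<close>, of the gain at the child of
    \<open>n\<close> along \<open>(a, e)\<close>. The child ends one time step later, hence
    \<open>Suc\<close>, and \<open>X\<close> expects codes in chronological order, hence
    \<open>rev_code\<close>.\<close>
  define G where "G s n a e =
    D s (Suc (length_code n)) * (R e * X s (rev_code (child_code n a e)))" for s n a e
  have G_rec: "recursive (\<lambda>x. G (s x) (n x) (a x) (e x))"
    if "recursive s" "recursive n" "recursive a" "recursive e" for s n a e
    unfolding G_def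
    by (intro recursive_intros that recursive_comp2[OF D(1)] recursive_comp2[OF X(1)]
        recursive_comp[OF R_rec])
  have G_mono: "8 * G s n a e \<le> G (Suc s) n a e" for s n a e
  proof -
    have "8 * G s n a e = (2 * D s (Suc (length_code n))) *
        (R e * (4 * X s (rev_code (child_code n a e))))"
      by (simp add: G_def)
    also have "\<dots> \<le> G (Suc s) n a e"
      unfolding G_def by (intro mult_mono D(2) X(2)) auto
    finally show ?thesis .
  qed

  \<comment> \<open>This is \<open>gain\<close> with the rewards rounded down, the limit of the
    quotients formed from \<open>G\<close>.\<close>
  define g where "g h = \<gamma> (length h) * (r (snd (last h)) / 2 ^ m * \<xi> h)" for h
  define code :: "('a, 'e) history \<Rightarrow> nat" where "code = reverse_history_code"
  define W where "W s h = stage_value CARD('a) CARD('e) (G s) s (code h) / (8 ^ s * 2 ^ m)" for s h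
  define Q where "Q s h k =
    stage_action_value CARD('a) CARD('e) (G s) s (code h) k / (8 ^ s * 2 ^ m)" for s h k
  define gs where "gs s h a e = G s (code h) (finite_code (a :: 'a)) (finite_code (e :: 'e))
    / (8 ^ s * 2 ^ m)" for s h a e

  \<comment> \<open>Monotonicity, bounds and limits of the stages\<close>
  have gs_lim: "(\<lambda>s. gs s h a e) \<longlonglongrightarrow> g (h @ [(a, e)])" for h a e
  proof -
    have "(\<lambda>s. D s (Suc (length h)) / 2 ^ s) \<longlonglongrightarrow> \<gamma> (Suc (length h))"
      using D(4)[of "Suc (length h)"] by simp
    then have "(\<lambda>s. D s (Suc (length h)) / 2 ^ s *
          (r e / 2 ^ m * (X s (history_code (h @ [(a, e)])) / 4 ^ s)))
        \<longlonglongrightarrow> \<gamma> (Suc (length h)) * (r e / 2 ^ m * \<xi> (h @ [(a, e)]))"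
      by (intro tendsto_mult tendsto_const X(3))
    moreover have "g (h @ [(a, e)]) = \<gamma> (Suc (length h)) * (r e / 2 ^ m * \<xi> (h @ [(a, e)]))"
      by (simp add: g_def)
    moreover have "gs s h a e = D s (Suc (length h)) / 2 ^ s *
        (r e / 2 ^ m * (X s (history_code (h @ [(a, e)])) / 4 ^ s))" for s
    proof -
      have "(8::real) ^ s = 2 ^ s * 4 ^ s"
        by (simp flip: power_mult_distrib)
      then show ?thesis
        by (simp add: gs_def G_def code_def R_code)
    qed
    ultimately show ?thesis by simp
  qed
  have gs_le: "gs s h a e \<le> \<gamma> (Suc (length h)) * \<xi> (h @ [(a, e)])" for s h a e
  proof -
    have "gs s h a e \<le> g (h @ [(a, e)])"
      using incseq_scaled[of 8 "\<lambda>s. G s (code h) (finite_code a) (finite_code e)" "2 ^ m"] G_mono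
        incseq_le[OF _ gs_lim] by (simp add: gs_def)
    also have "\<dots> \<le> \<gamma> (Suc (length h)) * \<xi> (h @ [(a, e)])"
    proof -
      have "r e / 2 ^ m \<le> 1"
        using r(1)[of e] reward_le_1[of e] by linarith
      then have "r e / 2 ^ m * \<xi> (h @ [(a, e)]) \<le> \<xi> (h @ [(a, e)])"
        by (intro mult_left_le_one_le nonneg) simp_all
      then have "\<gamma> (Suc (length h)) * (r e / 2 ^ m * \<xi> (h @ [(a, e)]))
          \<le> \<gamma> (Suc (length h)) * \<xi> (h @ [(a, e)])"
        by (rule mult_left_mono[OF _ discount_nonneg])
      then show ?thesis
        by (simp add: g_def)
    qed
    finally show ?thesis .
  qed
  have Q_eq: "Q s h (finite_code a) = (\<Sum>e\<in>UNIV. gs s h a e + W s (h @ [(a, e)]))" for s h a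
    by (simp add: Q_def gs_def W_def stage_action_value_def sum_finite_code code_def
        sum_divide_distrib add_divide_distrib)
  have Q_le: "Q s h (finite_code a) \<le> W s h" if "code h < s" for s h and a :: 'a
    unfolding Q_def W_def using that finite_code_less[of a]
    by (intro divide_right_mono) (simp_all add: stage_value_eq[of _ _ _ s "code h"] max_below_ge)
  have W_eq: "W s h = Q s h (argmax_below CARD('a) (stage_action_value CARD('a) CARD('e) (G s) s (code h)))"
    if "code h < s" for s h
    using that by (simp add: W_def Q_def argmax_below stage_value_eq[of _ _ _ s "code h"])
  have W_0: "W s h = 0" if "\<not> code h < s" for s h
    using that by (simp add: W_def stage_value_eq[of _ _ _ s "code h"])
  have W_nonneg: "0 \<le> W s h" and Q_nonneg: "0 \<le> Q s h k" for s h k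
    by (simp_all add: W_def Q_def)
  have W_mono: "incseq (\<lambda>s. W s h)" for h
    unfolding W_def
    using incseq_scaled[of 8 "\<lambda>s. stage_value CARD('a) CARD('e) (G s) s (code h)" "2 ^ m"]
      stage_value_mono[of 8 G, OF G_mono] by simp
  have Q_mono: "incseq (\<lambda>s. Q s h k)" for h k
  proof -
    have "8 * stage_action_value CARD('a) CARD('e) (G s) s n k
        \<le> stage_action_value CARD('a) CARD('e) (G (Suc s)) (Suc s) n k" for s n
      unfolding stage_action_value_def
      by (intro sum_mult_le) (simp add: distrib_left add_mono G_mono stage_value_mono)
    then show ?thesis
      unfolding Q_def
      using incseq_scaled[of 8 "\<lambda>s. stage_action_value CARD('a) CARD('e) (G s) s (code h) k" "2 ^ m"]
      by simp
  qed
  \<comment> \<open>The value for the constant reward 1 is an upper bound. It makes the stages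
    converge, and in the limit it supplies the bound on \<open>V\<close> by which relative losses
    become absolute ones.\<close>
  have W_le: "W s h \<le> discount_tail \<gamma> (Suc (length h)) * \<xi> h" for s h
  proof (induction "s - code h" arbitrary: h rule: less_induct)
    case less
    show ?case
    proof (cases "code h < s")
      case True
      obtain a :: 'a where "finite_code a
          = argmax_below CARD('a) (stage_action_value CARD('a) CARD('e) (G s) s (code h))"
        using finite_code_surj argmax_below(1) by (metis zero_less_card_finite)
      then have "W s h = (\<Sum>e\<in>UNIV. gs s h a e + W s (h @ [(a, e)]))"
        using W_eq[OF True] by (simp flip: Q_eq)
      also have "\<dots> \<le> (\<Sum>e\<in>UNIV. \<gamma> (Suc (length h)) * \<xi> (h @ [(a, e)]) +
          discount_tail \<gamma> (Suc (Suc (length h))) * \<xi> (h @ [(a, e)]))"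
      proof (intro sum_mono add_mono gs_le)
        fix e
        have "code h < code (h @ [(a, e)])"
          using child_code_gt[of "code h" "finite_code a" "finite_code e"] by (simp add: code_def)
        then have "W s (h @ [(a, e)])
            \<le> discount_tail \<gamma> (Suc (length (h @ [(a, e)]))) * \<xi> (h @ [(a, e)])"
          using True by (intro less) simp
        then show "W s (h @ [(a, e)])
            \<le> discount_tail \<gamma> (Suc (Suc (length h))) * \<xi> (h @ [(a, e)])"
          by simp
      qed
      also have "\<dots> = discount_tail \<gamma> (Suc (length h)) * (\<Sum>e\<in>UNIV. \<xi> (h @ [(a, e)]))"
        by (simp add: discount_tail_eq[of "Suc (length h)"] sum_distrib_left algebra_simps)
      also have "\<dots> \<le> discount_tail \<gamma> (Suc (length h)) * \<xi> h"
        by (intro mult_left_mono chronological discount_tail_nonneg)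
      finally show ?thesis .
    qed (simp add: W_0 discount_tail_nonneg nonneg)
  qed
  have "\<exists>L. (\<lambda>s. W s h) \<longlonglongrightarrow> L \<and> (\<forall>s. W s h \<le> L)" for h
    using incseq_convergent[OF W_mono[of h]] W_le by metis
  then obtain V where V: "\<And>h. (\<lambda>s. W s h) \<longlonglongrightarrow> V h"
    by metis
  have Q_lim: "(\<lambda>s. Q s h (finite_code a)) \<longlonglongrightarrow> (\<Sum>e\<in>UNIV. g (h @ [(a, e)]) + V (h @ [(a, e)]))" for h a
    unfolding Q_eq by (intro tendsto_intros gs_lim V)

  \<comment> \<open>\<open>1 / C (length h)\<close> is the loss permitted at \<open>h\<close>,
    namely \<open>\<eta> / 2 ^ Suc (length h)\<close> with \<open>\<eta> = 1 / 2 ^ m\<close>. Its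
    reciprocal is an integer, so the test for keeping an action is one between natural
    numbers.\<close>
  define C :: "nat \<Rightarrow> nat" where "C k = 2 ^ (m + Suc k)" for k
  define b where "b h s = stage_choice CARD('a) CARD('e) G (C (length h)) (code h) s" for h s
  have "\<exists>a. \<exists>S. (\<forall>s\<ge>S. b h s = finite_code (a :: 'a)) \<and>
      (\<forall>s\<ge>S. (1 - 1 / 2 ^ m / 2 ^ Suc (length h)) * W s h \<le> Q s h (finite_code a))" for h
  proof -
    define c :: real where "c = 1 / 2 ^ m / 2 ^ Suc (length h)"
    have c: "c = 1 / C (length h)"
      by (simp add: c_def C_def power_add)
    have C_pos: "1 \<le> C (length h)"
      by (simp add: C_def)
    define best where "best s = argmax_below CARD('a) (stage_action_value CARD('a) CARD('e) (G s) s (code h))" for s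
    \<comment> \<open>The integer test in \<open>stage_choice\<close> is the condition of
      \<open>stable_choice\<close> with denominators cleared; the common factor
      \<open>8 ^ s * 2 ^ m\<close> of \<open>W\<close> and \<open>Q\<close> cancels.\<close>
    have cond: "(C (length h) - 1) * stage_value CARD('a) CARD('e) (G s) s (code h)
        \<le> C (length h) * stage_action_value CARD('a) CARD('e) (G s) s (code h) k
        \<longleftrightarrow> (1 - c) * W s h \<le> Q s h k" for s k
    proof -
      have "(C (length h) - 1) * stage_value CARD('a) CARD('e) (G s) s (code h)
        \<le> C (length h) * stage_action_value CARD('a) CARD('e) (G s) s (code h) k \<longleftrightarrow>
        (real (C (length h)) - 1) * stage_value CARD('a) CARD('e) (G s) s (code h)
        \<le> real (C (length h)) * stage_action_value CARD('a) CARD('e) (G s) s (code h) k"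
        using C_pos by (simp only: of_nat_diff of_nat_mult of_nat_1 flip: of_nat_le_iff[where 'a = real])
      also have "\<dots> \<longleftrightarrow> (1 - c) * stage_value CARD('a) CARD('e) (G s) s (code h)
          \<le> stage_action_value CARD('a) CARD('e) (G s) s (code h) k"
        using C_pos by (simp add: c field_simps)
      also have "\<dots> \<longleftrightarrow> (1 - c) * W s h \<le> Q s h k"
        unfolding W_def Q_def times_divide_eq_right
        by (subst divide_le_cancel) (simp add: mult_less_0_iff)
      finally show ?thesis .
    qed
    have step: "b h (Suc s) = (if (1 - c) * W s h \<le> Q s h (b h s) then b h s else best s)" for s
      unfolding b_def stage_choice.simps cond best_def by (rule refl)
    have best: "W s h \<le> Q s h (best s)" for s
    proof (cases "code h < s")
      case True
      then show ?thesis
        by (simp add: W_eq best_def)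
    qed (simp add: W_0 Q_nonneg)
    have "0 < c" "c \<le> 1"
      using C_pos by (simp_all add: c)
    from stable_choice[OF step Q_nonneg Q_mono best W_nonneg W_mono V this]
    obtain S where S: "\<And>s. S \<le> s \<Longrightarrow> b h s = b h S" "\<And>s. S \<le> s \<Longrightarrow> (1 - c) * W s h \<le> Q s h (b h S)"
      by blast
    obtain a :: 'a where a: "finite_code a = b h S"
      using finite_code_surj stage_choice_less unfolding b_def by (metis zero_less_card_finite)
    show ?thesis
      using S unfolding a[symmetric] c_def by blast
  qed
  then obtain \<pi> where \<pi>: "\<And>h. \<exists>S. (\<forall>s\<ge>S. b h s = finite_code (\<pi> h :: 'a)) \<and>
      (\<forall>s\<ge>S. (1 - 1 / 2 ^ m / 2 ^ Suc (length h)) * W s h \<le> Q s h (finite_code (\<pi> h)))"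
    by metis

  \<comment> \<open>Near-optimality of the limit policy\<close>
  have near: "policy_value \<gamma> reward \<xi> \<pi>' h \<le> policy_value \<gamma> reward \<xi> \<pi> h + (1 / 2 ^ m + 1 / 2 ^ m)" for \<pi>' h
  proof (rule policy_value_near_optimal[where g = g and W = V])
    show "g h \<le> gain h" for h
      unfolding g_def gain_def by (intro mult_left_mono mult_right_mono r(1) discount_nonneg nonneg)
    show "gain h \<le> g h + 1 / 2 ^ m * (\<gamma> (length h) * \<xi> h)" for h
    proof -
      have "gain h \<le> \<gamma> (length h) * ((r (snd (last h)) / 2 ^ m + 1 / 2 ^ m) * \<xi> h)"
        unfolding gain_def by (intro mult_left_mono mult_right_mono r(2) discount_nonneg nonneg)
      then show ?thesis
        by (simp add: g_def algebra_simps)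
    qed
    show "0 \<le> g h" for h
      by (simp add: g_def discount_nonneg nonneg)
    show "0 \<le> V h" for h
      using V W_nonneg by (intro LIMSEQ_le_const[of "\<lambda>s. W s h"]) auto
    show "V h \<le> discount_tail \<gamma> (Suc (length h)) * \<xi> h" for h
      using V W_le by (intro LIMSEQ_le_const2[of "\<lambda>s. W s h"]) auto
    \<comment> \<open>The inequality passes to the limit from stages beyond the code of
      \<open>h\<close>; up to that stage the cut-off sets \<open>W\<close> to 0 and it may
      fail.\<close>
    show "(\<Sum>e\<in>UNIV. g (h @ [(a, e)]) + V (h @ [(a, e)])) \<le> V h" for h a
      using Q_le[of h _ a] by (intro LIMSEQ_le[OF Q_lim V] exI[of _ "Suc (code h)"]) auto
    show "(1 - 1 / 2 ^ m / 2 ^ Suc (length h)) * V h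
        \<le> (\<Sum>e\<in>UNIV. g (h @ [(\<pi> h, e)]) + V (h @ [(\<pi> h, e)]))" for h
      using \<pi>[of h] by (intro LIMSEQ_le[OF tendsto_mult_left[OF V] Q_lim]) blast
  qed simp_all
  have "optimal_value \<gamma> reward \<xi> h - policy_value \<gamma> reward \<xi> \<pi> h < \<epsilon>" for h
  proof -
    have "optimal_value \<gamma> reward \<xi> h \<le> policy_value \<gamma> reward \<xi> \<pi> h + (1 / 2 ^ m + 1 / 2 ^ m)"
      unfolding optimal_value_def by (intro cSUP_least near) simp
    with m show ?thesis by simp
  qed

  \<comment> \<open>The policy graph as a limit\<close>
  moreover have "Delta02 (policy_graph_code \<pi>)"
  proof (rule Delta02_limitI)
    \<comment> \<open>The graph uses chronological codes and \<open>stage_choice\<close> reversed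
      ones, hence \<open>rev_code\<close>. If the first component codes no history, the result
      differs from 1 at every stage, whatever \<open>stage_choice\<close> computes there.\<close>
    define f where "f s x = (if stage_choice CARD('a) CARD('e) G
        (C (length_code (rev_code (fst (prod_decode x))))) (rev_code (fst (prod_decode x))) s
        = snd (prod_decode x)
      then valid_code CARD('a) CARD('e) (fst (prod_decode x)) else 0)" for s x
    show "recursive (\<lambda>y. f (fst (prod_decode y)) (snd (prod_decode y)))"
      unfolding f_def C_def
      by (intro recursive_if_eq recursive_stage_choice[of G] G_rec recursive_intros)
    fix x
    show "\<exists>S. \<forall>s\<ge>S. f s x = 1 \<longleftrightarrow> x \<in> policy_graph_code \<pi>"
    proof (cases "\<exists>h :: ('a, 'e) history. fst (prod_decode x) = history_code h")
      case True
      then obtain h :: "('a, 'e) history" and k where x: "x = prod_encode (history_code h, k)"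
        by (metis prod_decode_inverse prod.collapse)
      obtain S where S: "\<And>s. S \<le> s \<Longrightarrow> b h s = finite_code (\<pi> h)"
        using \<pi> by blast
      have "valid_code CARD('a) CARD('e) (history_code h) = 1"
        using valid_code_eq_1 by blast
      then have "f s x = 1 \<longleftrightarrow> b h s = k" for s
        by (simp add: f_def x b_def code_def)
      moreover have "x \<in> policy_graph_code \<pi> \<longleftrightarrow> finite_code (\<pi> h) = k"
        using inj_history_code by (auto simp: policy_graph_code_def x dest: injD)
      ultimately show ?thesis
        using S by (intro exI[of _ S]) simp
    next
      case False
      then have "f s x \<noteq> 1" for s
        using valid_code_eq_1[where 'a='a and 'e='e] by (auto simp: f_def)
      moreover have "x \<notin> policy_graph_code \<pi>"
        using False by (auto simp: policy_graph_code_def)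
      ultimately show ?thesis by blast
    qed
  qed
  ultimately show ?thesis
    unfolding \<xi>_def by blast
qed

end
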